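(* The linear map $\psi:\mathfrak{g}^J\to\mathscr{K}(\mathbb{S}^J)$ defined by $$F\mapsto-\eta_2,\quad G\mapsto\tfrac14\dot\theta_1^2+\eta_2\dot\theta_2^2+\eta_1\dot\theta_1\dot\theta_2-\tfrac{1}{4(\eta_1^2-\eta_2)},\quad H\mapsto-\eta_1\dot\theta_1-2\eta_2\dot\theta_2,$$ $$P\mapsto\tfrac12\dot\theta_1+\eta_1\dot\theta_2,\quad Q\mapsto\eta_1,\quad R\mapsto-\tfrac14,$$ is an isomorphism of Lie algebras from the Lie algebra $\mathfrak{g}^J$ of the Jacobi group onto the Lie algebra $\mathscr{K}(\mathbb{S}^J)$ of Kähler functions on the Siegel-Jacobi space.
   Context: The Siegel-Jacobi space $\mathbb{S}^J$ is the complex manifold $\mathbb{H}\times\mathbb{C}$ ($\mathbb{H}$ the upper half-plane) with the Kähler metric $g_{KB}$ whose matrix in the coordinates $(u,v,x,y)$ ($\tau=u+iv\in\mathbb{H}$, $z=x+iy\in\mathbb{C}$) is $$\frac12\begin{bmatrix}\frac{v+y^2}{v^3}&0&-\frac{y}{v^2}&0\\0&\frac{v+y^2}{v^3}&0&-\frac{y}{v^2}\\-\frac{y}{v^2}&0&\frac1v&0\\0&-\frac{y}{v^2}&0&\frac1v\end{bmatrix},$$ and symplectic form $\omega_{KB}=g_{KB}(J\cdot,\cdot)$, $J$ being the complex structure. Coordinates $(\theta_1,\theta_2,\dot\theta_1,\dot\theta_2)$ on $\mathbb{S}^J$ ($\theta_2<0$) are defined by $\tau=\dot\theta_2-i\theta_2$,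 $z=-\dot\theta_1+i\theta_1$, and $\eta_1=-\frac{\theta_1}{2\theta_2}$, $\eta_2=\frac{\theta_1^2-2\theta_2}{4\theta_2^2}$. A smooth function $f$ on a Kähler manifold $(N,g,J,\omega)$ is a Kähler function if $\mathscr{L}_{X_f}g=0$, where $X_f$ is the Hamiltonian vector field, $\omega(X_f,\cdot)=df$. The space $\mathscr{K}(N)$ of Kähler functions is a Lie algebra for the Poisson bracket $\{f,g\}=\omega(X_f,X_g)$. The functions $\psi(L)$, $L\in\mathfrak{g}^J$, are Kähler functions on $\mathbb{S}^J$. $\mathfrak{g}^J=\mathfrak{sl}(2,\mathbb{R})\times\mathbb{R}^2\times\mathbb{R}$ with bracket $[(A,\xi,r),(B,\eta,s)]=([A,B],\xi B-\eta A,2\Omega(\xi,\eta))$, where $\xi,\eta$ are row vectors and $\Omega(\xi,\eta)=\xi_1\eta_2-\xi_2\eta_1$. Basis: $F=\big[\begin{smallmatrix}0&1\\0&0\end{smallmatrix}\big]$, $G=\big[\begin{smallmatrix}0&0\\1&0\end{smallmatrix}\big]$, $H=\big[\begin{smallmatrix}1&0\\0&-1\end{smallmatrix}\big]$ in $\mathfrak{sl}(2,\mathbb{R})$, and $P=(1,0,0)$, $Q=(0,1,0)$, $R=(0,0,1)$ in $\mathbb{R}^2\times\mathbb{R}$. *)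

theory Defs
  imports "HOL-Analysis.Analysis" "HOL-Library.Function_Algebras"
begin

section \<open>Real Lie algebras\<close>

text \<open>
  Lie algebras are carried by a subspace \<open>V\<close> of an ambient real vector space. The scalar
  multiplication is a parameter because function spaces (with the pointwise addition of
  \<^theory>\<open>HOL-Library.Function_Algebras\<close>) are not instances of \<^class>\<open>real_vector\<close>.
\<close>

locale real_lie_algebra = vector_space scale
  for scale :: "real \<Rightarrow> 'a::ab_group_add \<Rightarrow> 'a" +
  fixes V :: "'a set" and bracket :: "'a \<Rightarrow> 'a \<Rightarrow> 'a"
  assumes subspace_carrier: "subspace V"
    and bracket_closed: "x \<in> V \<Longrightarrow> y \<in> V \<Longrightarrow> bracket x y \<in> V"
    and bracket_add_left:
      "x \<in> V \<Longrightarrow> y \<in> V \<Longrightarrow> z \<in> V \<Longrightarrow> bracket (x + y) z = bracket x z + bracket y z"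
    and bracket_add_right:
      "x \<in> V \<Longrightarrow> y \<in> V \<Longrightarrow> z \<in> V \<Longrightarrow> bracket x (y + z) = bracket x y + bracket x z"
    and bracket_scale_left:
      "x \<in> V \<Longrightarrow> y \<in> V \<Longrightarrow> bracket (scale c x) y = scale c (bracket x y)"
    and bracket_scale_right:
      "x \<in> V \<Longrightarrow> y \<in> V \<Longrightarrow> bracket x (scale c y) = scale c (bracket x y)"
    and bracket_self: "x \<in> V \<Longrightarrow> bracket x x = 0"
    and jacobi_identity: "x \<in> V \<Longrightarrow> y \<in> V \<Longrightarrow> z \<in> V \<Longrightarrow>
      bracket x (bracket y z) + bracket y (bracket z x) + bracket z (bracket x y) = 0"

locale real_lie_algebra_iso =
  dom: real_lie_algebra scale\<^sub>1 V\<^sub>1 bracket\<^sub>1 + cod: real_lie_algebra scale\<^sub>2 V\<^sub>2 bracket\<^sub>2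
  for scale\<^sub>1 :: "real \<Rightarrow> 'a::ab_group_add \<Rightarrow> 'a" and V\<^sub>1 :: "'a set"
    and bracket\<^sub>1 :: "'a \<Rightarrow> 'a \<Rightarrow> 'a"
    and scale\<^sub>2 :: "real \<Rightarrow> 'b::ab_group_add \<Rightarrow> 'b" and V\<^sub>2 :: "'b set"
    and bracket\<^sub>2 :: "'b \<Rightarrow> 'b \<Rightarrow> 'b" +
  fixes h :: "'a \<Rightarrow> 'b"
  assumes bij: "bij_betw h V\<^sub>1 V\<^sub>2"
    and hom_add: "x \<in> V\<^sub>1 \<Longrightarrow> y \<in> V\<^sub>1 \<Longrightarrow> h (x + y) = h x + h y"
    and hom_scale: "x \<in> V\<^sub>1 \<Longrightarrow> h (scale\<^sub>1 c x) = scale\<^sub>2 c (h x)"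
    and hom_bracket: "x \<in> V\<^sub>1 \<Longrightarrow> y \<in> V\<^sub>1 \<Longrightarrow> h (bracket\<^sub>1 x y) = bracket\<^sub>2 (h x) (h y)"


section \<open>Kaehler functions on an open subset of a vector space\<close>

text \<open>
  The manifold is an open subset \<open>N\<close> of a finite-dimensional real vector space, so that every
  tangent space is that vector space. A metric is a family \<open>g p\<close> of bilinear forms; the complex
  structure \<open>J\<close> is constant, as it is in holomorphic coordinates.

  A function on \<open>N\<close> is represented by its extension by zero to the whole space. In this way
  equality and the pointwise operations are those of functions on \<open>N\<close>.
\<close>

definition zero_extension :: "'a set \<Rightarrow> ('a \<Rightarrow> real) \<Rightarrow> 'a \<Rightarrow> real"
  where "zero_extension N f = (\<lambda>p. if p \<in> N then f p else 0)"

definition fun_scale :: "real \<Rightarrow> ('a \<Rightarrow> real) \<Rightarrow> 'a \<Rightarrow> real"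
  where "fun_scale c f = (\<lambda>p. c * f p)"

primrec Ck_on :: "nat \<Rightarrow> 'a::euclidean_space set \<Rightarrow> ('a \<Rightarrow> real) \<Rightarrow> bool"
  where
    "Ck_on 0 N f \<longleftrightarrow> continuous_on N f"
  | "Ck_on (Suc k) N f \<longleftrightarrow>
      (\<forall>p\<in>N. f differentiable (at p)) \<and> (\<forall>v. Ck_on k N (\<lambda>p. frechet_derivative f (at p) v))"

definition smooth_fun_on :: "'a::euclidean_space set \<Rightarrow> ('a \<Rightarrow> real) \<Rightarrow> bool"
  where "smooth_fun_on N f \<longleftrightarrow> (\<forall>k. Ck_on k N f)"

definition kaehler_form ::
    "('a \<Rightarrow> 'a \<Rightarrow> 'a \<Rightarrow> real) \<Rightarrow> ('a \<Rightarrow> 'a) \<Rightarrow> 'a::euclidean_space \<Rightarrow> 'a \<Rightarrow> 'a \<Rightarrow> real"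
  where "kaehler_form g J p v w = g p (J v) w"

text \<open>The description below determines a unique vector wherever \<open>\<omega>\<close> is nondegenerate.\<close>

definition hamiltonian_field ::
    "('a \<Rightarrow> 'a \<Rightarrow> 'a \<Rightarrow> real) \<Rightarrow> ('a \<Rightarrow> real) \<Rightarrow> 'a::euclidean_space \<Rightarrow> 'a"
  where "hamiltonian_field \<omega> f p = (THE X. \<forall>w. \<omega> p X w = frechet_derivative f (at p) w)"

text \<open>
  \<open>(L\<^sub>X g)(Y, Z) = X (g (Y, Z)) - g ([X, Y], Z) - g (Y, [X, Z])\<close>, evaluated on the
  constant fields \<open>Y = v\<close> and \<open>Z = w\<close>, for which \<open>[X, v] = - DX(v)\<close>. In coordinates:
  \<open>(L\<^sub>X g)\<^sub>i\<^sub>j = X\<^sup>k \<partial>\<^sub>k g\<^sub>i\<^sub>j + g\<^sub>k\<^sub>j \<partial>\<^sub>i X\<^sup>k + g\<^sub>i\<^sub>k \<partial>\<^sub>j X\<^sup>k\<close>.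
\<close>

definition lie_derivative_metric ::
    "('a \<Rightarrow> 'a) \<Rightarrow> ('a \<Rightarrow> 'a \<Rightarrow> 'a \<Rightarrow> real) \<Rightarrow> 'a::euclidean_space \<Rightarrow> 'a \<Rightarrow> 'a \<Rightarrow> real"
  where "lie_derivative_metric X g p v w =
      frechet_derivative (\<lambda>q. g q v w) (at p) (X p)
      + g p (frechet_derivative X (at p) v) w
      + g p v (frechet_derivative X (at p) w)"

definition kaehler_functions ::
    "'a::euclidean_space set \<Rightarrow> ('a \<Rightarrow> 'a \<Rightarrow> 'a \<Rightarrow> real) \<Rightarrow> ('a \<Rightarrow> 'a) \<Rightarrow> ('a \<Rightarrow> real) set"
  where "kaehler_functions N g J =
      {f. (\<forall>p. p \<notin> N \<longrightarrow> f p = 0) \<and> smooth_fun_on N f \<and>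
          (\<forall>p\<in>N. \<forall>v w.
             lie_derivative_metric (hamiltonian_field (kaehler_form g J) f) g p v w = 0)}"

definition poisson_bracket ::
    "'a::euclidean_space set \<Rightarrow> ('a \<Rightarrow> 'a \<Rightarrow> 'a \<Rightarrow> real) \<Rightarrow> ('a \<Rightarrow> real) \<Rightarrow> ('a \<Rightarrow> real) \<Rightarrow> 'a \<Rightarrow> real"
  where "poisson_bracket N \<omega> f h =
      zero_extension N (\<lambda>p. \<omega> p (hamiltonian_field \<omega> f p) (hamiltonian_field \<omega> h p))"


section \<open>The Siegel-Jacobi space\<close>

definition SJ :: "(complex \<times> complex) set"
  where "SJ = {(\<tau>, z). Im \<tau> > 0}"

text \<open>Real coordinates \<open>(u, v, x, y)\<close> of \<open>(\<tau>, z) = (u + \<i> v, x + \<i> y)\<close>, also used for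
  tangent vectors.\<close>

definition real_coords :: "complex \<times> complex \<Rightarrow> real ^ 4"
  where "real_coords = (\<lambda>(\<tau>, z). vector [Re \<tau>, Im \<tau>, Re z, Im z])"

definition KB_matrix :: "complex \<times> complex \<Rightarrow> real ^ 4 ^ 4"
  where "KB_matrix = (\<lambda>(\<tau>, z). let v = Im \<tau>; y = Im z in
    (1 / 2) *\<^sub>R vector
      [vector [(v + y\<^sup>2) / v ^ 3, 0, - y / v\<^sup>2, 0],
       vector [0, (v + y\<^sup>2) / v ^ 3, 0, - y / v\<^sup>2],
       vector [- y / v\<^sup>2, 0, 1 / v, 0],
       vector [0, - y / v\<^sup>2, 0, 1 / v]])"

definition KB_metric ::
    "complex \<times> complex \<Rightarrow> complex \<times> complex \<Rightarrow> complex \<times> complex \<Rightarrow> real"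
  where "KB_metric p X Y = real_coords X \<bullet> (KB_matrix p *v real_coords Y)"

definition SJ_J :: "complex \<times> complex \<Rightarrow> complex \<times> complex"
  where "SJ_J = (\<lambda>(a, b). (\<i> * a, \<i> * b))"

abbreviation KB_form ::
    "complex \<times> complex \<Rightarrow> complex \<times> complex \<Rightarrow> complex \<times> complex \<Rightarrow> real"
  where "KB_form \<equiv> kaehler_form KB_metric SJ_J"

definition theta1 :: "complex \<times> complex \<Rightarrow> real"
  where "theta1 p = Im (snd p)"

definition theta2 :: "complex \<times> complex \<Rightarrow> real"
  where "theta2 p = - Im (fst p)"

definition thetadot1 :: "complex \<times> complex \<Rightarrow> real"
  where "thetadot1 p = - Re (snd p)"

definition thetadot2 :: "complex \<times> complex \<Rightarrow> real"
  where "thetadot2 p = Re (fst p)"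

lemma theta_coordinates:
  "fst p = of_real (thetadot2 p) - \<i> * of_real (theta2 p)"
  "snd p = - of_real (thetadot1 p) + \<i> * of_real (theta1 p)"
  by (simp_all add: theta1_def theta2_def thetadot1_def thetadot2_def complex_eq_iff)

definition eta1 :: "complex \<times> complex \<Rightarrow> real"
  where "eta1 p = - (theta1 p / (2 * theta2 p))"

definition eta2 :: "complex \<times> complex \<Rightarrow> real"
  where "eta2 p = ((theta1 p)\<^sup>2 - 2 * theta2 p) / (4 * (theta2 p)\<^sup>2)"


section \<open>The Lie algebra of the Jacobi group\<close>

type_synonym jacobi_vec = "(real ^ 2 ^ 2) \<times> (real ^ 2) \<times> real"

definition gJ :: "jacobi_vec set"
  where "gJ = {(A, \<xi>, r). trace A = 0}"

definition Omega :: "real ^ 2 \<Rightarrow> real ^ 2 \<Rightarrow> real"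
  where "Omega \<xi> \<eta> = \<xi> $ 1 * \<eta> $ 2 - \<xi> $ 2 * \<eta> $ 1"

definition gJ_bracket :: "jacobi_vec \<Rightarrow> jacobi_vec \<Rightarrow> jacobi_vec"
  where "gJ_bracket = (\<lambda>(A, \<xi>, r) (B, \<eta>, s).
    (A ** B - B ** A, \<xi> v* B - \<eta> v* A, 2 * Omega \<xi> \<eta>))"

definition gJ_F :: jacobi_vec where "gJ_F = (vector [vector [0, 1], vector [0, 0]], 0, 0)"
definition gJ_G :: jacobi_vec where "gJ_G = (vector [vector [0, 0], vector [1, 0]], 0, 0)"
definition gJ_H :: jacobi_vec where "gJ_H = (vector [vector [1, 0], vector [0, -1]], 0, 0)"
definition gJ_P :: jacobi_vec where "gJ_P = (0, vector [1, 0], 0)"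
definition gJ_Q :: jacobi_vec where "gJ_Q = (0, vector [0, 1], 0)"
definition gJ_R :: jacobi_vec where "gJ_R = (0, 0, 1)"

lemma gJ_basis_expansion:
  assumes "(A, \<xi>, r) \<in> gJ"
  shows "(A, \<xi>, r) =
    (A $ 1 $ 2) *\<^sub>R gJ_F + (A $ 2 $ 1) *\<^sub>R gJ_G + (A $ 1 $ 1) *\<^sub>R gJ_H
    + (\<xi> $ 1) *\<^sub>R gJ_P + (\<xi> $ 2) *\<^sub>R gJ_Q + r *\<^sub>R gJ_R"
  using assms
  by (auto simp: gJ_def trace_def sum_2 vec_eq_iff forall_2 vector_2
      gJ_F_def gJ_G_def gJ_H_def gJ_P_def gJ_Q_def gJ_R_def)


section \<open>The map \<open>\<psi>\<close>\<close>

text \<open>The coefficients are those of the lemma \<open>gJ_basis_expansion\<close>.\<close>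

definition psi :: "jacobi_vec \<Rightarrow> complex \<times> complex \<Rightarrow> real"
  where "psi = (\<lambda>(A, \<xi>, r). zero_extension SJ (\<lambda>p.
      A $ 1 $ 2 * (- eta2 p)
    + A $ 2 $ 1 * (1 / 4 * (thetadot1 p)\<^sup>2 + eta2 p * (thetadot2 p)\<^sup>2
        + eta1 p * thetadot1 p * thetadot2 p - 1 / (4 * ((eta1 p)\<^sup>2 - eta2 p)))
    + A $ 1 $ 1 * (- eta1 p * thetadot1 p - 2 * eta2 p * thetadot2 p)
    + \<xi> $ 1 * (1 / 2 * thetadot1 p + eta1 p * thetadot2 p)
    + \<xi> $ 2 * eta1 p
    + r * (- 1 / 4)))"

lemma psi_basis:
  assumes "p \<in> SJ"
  shows "psi gJ_F p = - eta2 p"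
    and "psi gJ_G p = 1 / 4 * (thetadot1 p)\<^sup>2 + eta2 p * (thetadot2 p)\<^sup>2
          + eta1 p * thetadot1 p * thetadot2 p - 1 / (4 * ((eta1 p)\<^sup>2 - eta2 p))"
    and "psi gJ_H p = - eta1 p * thetadot1 p - 2 * eta2 p * thetadot2 p"
    and "psi gJ_P p = 1 / 2 * thetadot1 p + eta1 p * thetadot2 p"
    and "psi gJ_Q p = eta1 p"
    and "psi gJ_R p = - 1 / 4"
  using assms
  by (simp_all add: psi_def zero_extension_def vector_2
      gJ_F_def gJ_G_def gJ_H_def gJ_P_def gJ_Q_def gJ_R_def)

end

theory Submission
  imports Defs "HOL-Complex_Analysis.Complex_Analysis"
begin

text \<open>
  The Hamiltonian field \<open>X\<close> of a Kaehler function preserves both \<open>g\<close> and \<open>\<omega>\<close>, so it is holomorphic in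
  \<open>(\<tau>, z)\<close>, and the Killing equation becomes a system of three equations for its two holomorphic
  components. On a fibre \<open>\<tau> = const\<close> that system forces the components to be polynomials in \<open>z\<close> of
  degree at most \<open>2\<close> and \<open>3\<close>; the coefficients are holomorphic in \<open>\<tau>\<close> and satisfy relations
  involving \<open>Im \<tau>\<close> and complex conjugates, which kill the higher ones and leave
  \<open>X = (a \<tau>\<^sup>2 + 2 c \<tau> + d, (a \<tau> + c) z + l \<tau> + m)\<close> with five real parameters. These are exactly the
  Hamiltonian fields of the functions \<open>\<psi>(L)\<close>, so a Kaehler function is some \<open>\<psi>(L)\<close> up to an additive
  constant, and the constants are the multiples of \<open>\<psi>(R)\<close>. That \<open>\<psi>\<close> preserves brackets is a
  computation with the explicit fields, and the Lie algebra axioms for the Poisson bracket are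
  transported along \<open>\<psi>\<close>.
\<close>

section \<open>Functions of class \<open>C\<^sup>k\<close>\<close>

text \<open>The mean value theorem is applied twice: along \<open>v\<close> to the increment
  \<open>\<phi>\<close> of \<open>f\<close> over the step \<open>h\<close> in direction
  \<open>w\<close>, then along \<open>w\<close> to the directional derivative
  \<open>A\<close>.\<close>

lemma second_difference_mvt:
  fixes f :: "'a::euclidean_space \<Rightarrow> real"
  assumes h: "h > 0"
    and N: "\<And>s t. 0 \<le> s \<Longrightarrow> s \<le> h \<Longrightarrow> 0 \<le> t \<Longrightarrow> t \<le> h \<Longrightarrow> p + s *\<^sub>R v + t *\<^sub>R w \<in> N"
    and df: "\<And>q. q \<in> N \<Longrightarrow> f differentiable (at q)"
    and ddf: "\<And>q. q \<in> N \<Longrightarrow> (\<lambda>q. frechet_derivative f (at q) v) differentiable (at q)"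
  obtains s t where "0 < s" "s < h" "0 < t" "t < h"
    "f (p + h *\<^sub>R v + h *\<^sub>R w) - f (p + h *\<^sub>R v) - f (p + h *\<^sub>R w) + f p
      = h\<^sup>2 * frechet_derivative (\<lambda>q. frechet_derivative f (at q) v) (at (p + s *\<^sub>R v + t *\<^sub>R w)) w"
proof -
  define A where "A = (\<lambda>q. frechet_derivative f (at q) v)"
  have line: "((\<lambda>s. F (q + s *\<^sub>R d)) has_real_derivative frechet_derivative F (at (q + s *\<^sub>R d)) d) (at s)"
    if "F differentiable (at (q + s *\<^sub>R d))" for F :: "'a \<Rightarrow> real" and q d s
  proof -
    have "(F has_derivative frechet_derivative F (at (q + s *\<^sub>R d))) (at (q + s *\<^sub>R d))"
      using that frechet_derivative_works by blast
    then have "(F \<circ> (\<lambda>s. q + s *\<^sub>R d) has_derivative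
        frechet_derivative F (at (q + s *\<^sub>R d)) \<circ> (\<lambda>h. h *\<^sub>R d)) (at s)"
      by (intro diff_chain_at) (auto intro!: derivative_eq_intros)
    moreover have "linear (frechet_derivative F (at (q + s *\<^sub>R d)))"
      by (simp add: linear_frechet_derivative that)
    then have "frechet_derivative F (at (q + s *\<^sub>R d)) \<circ> (\<lambda>h. h *\<^sub>R d)
        = (*) (frechet_derivative F (at (q + s *\<^sub>R d)) d)"
      by (auto simp: fun_eq_iff linear_cmul)
    ultimately show ?thesis
      by (simp add: has_field_derivative_def o_def)
  qed
  define \<phi> where "\<phi> = (\<lambda>s. f (p + h *\<^sub>R w + s *\<^sub>R v) - f (p + s *\<^sub>R v))"
  have d1: "(\<phi> has_real_derivative A (p + h *\<^sub>R w + s *\<^sub>R v) - A (p + s *\<^sub>R v)) (at s)"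
    if "0 \<le> s" "s \<le> h" for s
    unfolding \<phi>_def A_def
    by (intro DERIV_diff line df) (use N[OF that, of h] N[OF that, of 0] h in \<open>simp_all add: algebra_simps\<close>)
  obtain s where s: "0 < s" "s < h"
    "\<phi> h - \<phi> 0 = (h - 0) * (A (p + h *\<^sub>R w + s *\<^sub>R v) - A (p + s *\<^sub>R v))"
    using MVT2[OF h d1] by blast
  have d2: "((\<lambda>t. A ((p + s *\<^sub>R v) + t *\<^sub>R w)) has_real_derivative
      frechet_derivative A (at ((p + s *\<^sub>R v) + t *\<^sub>R w)) w) (at t)" if "0 \<le> t" "t \<le> h" for t
    by (intro line ddf[folded A_def] N) (use s that in auto)
  obtain t where t: "0 < t" "t < h"
    "A ((p + s *\<^sub>R v) + h *\<^sub>R w) - A ((p + s *\<^sub>R v) + 0 *\<^sub>R w)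
      = (h - 0) * frechet_derivative A (at ((p + s *\<^sub>R v) + t *\<^sub>R w)) w"
    using MVT2[OF h d2] by blast
  show thesis
  proof (rule that[OF s(1,2) t(1,2)])
    have "f (p + h *\<^sub>R v + h *\<^sub>R w) - f (p + h *\<^sub>R v) - f (p + h *\<^sub>R w) + f p = \<phi> h - \<phi> 0"
      by (simp add: \<phi>_def algebra_simps)
    also have "\<dots> = h * (A ((p + s *\<^sub>R v) + h *\<^sub>R w) - A ((p + s *\<^sub>R v) + 0 *\<^sub>R w))"
      using s(3) by (simp add: algebra_simps)
    also have "\<dots> = h\<^sup>2 * frechet_derivative A (at (p + s *\<^sub>R v + t *\<^sub>R w)) w"
      unfolding t(3) by (simp add: power2_eq_square)
    finally show "f (p + h *\<^sub>R v + h *\<^sub>R w) - f (p + h *\<^sub>R v) - f (p + h *\<^sub>R w) + f p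
      = h\<^sup>2 * frechet_derivative (\<lambda>q. frechet_derivative f (at q) v) (at (p + s *\<^sub>R v + t *\<^sub>R w)) w"
      by (simp add: A_def)
  qed
qed

text \<open>The second difference is symmetric in \<open>v\<close> and \<open>w\<close>, so the two
  orders of the mean value theorem give the same number as a mixed derivative at two points close to
  \<open>p\<close>. Continuity of both mixed derivatives then excludes a gap between their values at
  \<open>p\<close>.\<close>

lemma second_frechet_derivative_symmetric:
  fixes f :: "'a::euclidean_space \<Rightarrow> real"
  assumes "open N" "p \<in> N" "Ck_on 2 N f"
  shows "frechet_derivative (\<lambda>q. frechet_derivative f (at q) v) (at p) w
       = frechet_derivative (\<lambda>q. frechet_derivative f (at q) w) (at p) v"
proof (rule ccontr)
  define D where "D = (\<lambda>v w q. frechet_derivative (\<lambda>q. frechet_derivative f (at q) v) (at q) w)"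
  assume "\<not> ?thesis"
  then have ne: "D v w p \<noteq> D w v p"
    by (simp add: D_def)
  define e where "e = \<bar>D v w p - D w v p\<bar> / 2"
  have e: "e > 0"
    using ne by (simp add: e_def)
  have df: "\<And>q. q \<in> N \<Longrightarrow> f differentiable (at q)"
    and ddf: "\<And>q v. q \<in> N \<Longrightarrow> (\<lambda>q. frechet_derivative f (at q) v) differentiable (at q)"
    and "\<And>v w. continuous_on N (D v w)"
    using assms(3) by (simp_all add: numeral_2_eq_2 D_def)
  then have "\<And>v w. isCont (D v w) p"
    using assms continuous_on_eq_continuous_at by blast
  then have "\<forall>v w. \<exists>d>0. \<forall>q. dist q p < d \<longrightarrow> dist (D v w q) (D v w p) < e"
    using e by (simp add: continuous_at_eps_delta)
  then obtain d where d: "\<And>v w. d v w > 0"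
    "\<And>v w q. dist q p < d v w \<Longrightarrow> dist (D v w q) (D v w p) < e"
    by metis
  obtain r where r: "r > 0" "ball p r \<subseteq> N"
    using assms openE by blast
  define m where "m = min r (min (d v w) (d w v))"
  have m: "m > 0"
    using r d by (simp add: m_def)
  \<comment> \<open>This makes the parallelogram on \<open>h *\<^sub>R v\<close> and
    \<open>h *\<^sub>R w\<close> lie within \<open>m\<close> of \<open>p\<close>; the summand 1
    covers \<open>v = w = 0\<close>.\<close>
  define h where "h = m / (norm v + norm w + 1)"
  have h: "h > 0"
    using m by (simp add: h_def add_nonneg_pos)
  have near: "dist (p + s *\<^sub>R a + t *\<^sub>R b) p < m"
    if "0 \<le> s" "s \<le> h" "0 \<le> t" "t \<le> h" "{a, b} = {v, w}" for s t a b
  proof -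
    have nab: "norm a + norm b = norm v + norm w"
      using that(5) by (auto simp: doubleton_eq_iff)
    have "dist (p + s *\<^sub>R a + t *\<^sub>R b) p \<le> s * norm a + t * norm b"
      using norm_triangle_ineq[of "s *\<^sub>R a" "t *\<^sub>R b"] that by (simp add: dist_norm add.assoc)
    also have "\<dots> \<le> h * norm a + h * norm b"
      using that by (intro add_mono mult_right_mono) auto
    also have "\<dots> = h * (norm v + norm w)"
      by (metis distrib_left nab)
    also have "\<dots> < h * (norm v + norm w + 1)"
      using h by (simp add: algebra_simps)
    also have "\<dots> = m"
      using add_nonneg_pos[of "norm v + norm w" 1] by (simp add: h_def)
    finally show ?thesis .
  qed
  have inN: "p + s *\<^sub>R a + t *\<^sub>R b \<in> N"
    if "0 \<le> s" "s \<le> h" "0 \<le> t" "t \<le> h" "{a, b} = {v, w}" for s t a b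
    using near[OF that] r by (auto simp: m_def dist_commute)
  obtain s t where st: "0 < s" "s < h" "0 < t" "t < h"
    "f (p + h *\<^sub>R v + h *\<^sub>R w) - f (p + h *\<^sub>R v) - f (p + h *\<^sub>R w) + f p
      = h\<^sup>2 * D v w (p + s *\<^sub>R v + t *\<^sub>R w)"
    unfolding D_def by (rule second_difference_mvt[of h p v w N f, OF h inN df ddf]) auto
  obtain s' t' where st': "0 < s'" "s' < h" "0 < t'" "t' < h"
    "f (p + h *\<^sub>R w + h *\<^sub>R v) - f (p + h *\<^sub>R w) - f (p + h *\<^sub>R v) + f p
      = h\<^sup>2 * D w v (p + s' *\<^sub>R w + t' *\<^sub>R v)"
    unfolding D_def by (rule second_difference_mvt[of h p w v N f, OF h inN df ddf]) auto
  have "h\<^sup>2 * D v w (p + s *\<^sub>R v + t *\<^sub>R w) = h\<^sup>2 * D w v (p + s' *\<^sub>R w + t' *\<^sub>R v)"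
    unfolding st(5)[symmetric] st'(5)[symmetric] by (simp add: algebra_simps)
  then have "D v w (p + s *\<^sub>R v + t *\<^sub>R w) = D w v (p + s' *\<^sub>R w + t' *\<^sub>R v)"
    using h by simp
  moreover have "dist (D v w (p + s *\<^sub>R v + t *\<^sub>R w)) (D v w p) < e"
    using near[of s t v w] st by (intro d) (simp add: m_def)
  moreover have "dist (D w v (p + s' *\<^sub>R w + t' *\<^sub>R v)) (D w v p) < e"
    using near[of s' t' w v] st' by (intro d) (simp add: m_def insert_commute)
  moreover have "x \<noteq> y" if "dist x a < \<bar>a - b\<bar> / 2" "dist y b < \<bar>a - b\<bar> / 2" for x y a b :: real
    using that dist_triangle2[of a b x] by (auto simp: dist_real_def abs_minus_commute)
  ultimately show False
    unfolding e_def by metis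
qed

section \<open>Closure properties of the classes C^k\<close>

text \<open>At a point of an open set the derivative depends only on values inside the set, so a
  formula valid on \<open>N\<close> alone decides the class, whatever the extension outside.\<close>

lemma Ck_on_cong:
  assumes "open N" "\<And>p. p \<in> N \<Longrightarrow> f p = g p" "Ck_on k N f"
  shows "Ck_on k N g"
  using assms(2,3)
proof (induction k arbitrary: f g)
  case 0
  then show ?case
    using continuous_on_cong by auto
next
  case (Suc k)
  have fd: "frechet_derivative f (at p) = frechet_derivative g (at p)" if "p \<in> N" for p
    using frechet_derivative_transform_within_open[OF _ assms(1) that, of f g] Suc.prems that by auto
  have "g differentiable (at p)" if "p \<in> N" for p
    using Suc.prems that has_derivative_transform_within_open[OF _ assms(1) that]
    unfolding differentiable_def Ck_on.simps by meson
  moreover have "Ck_on k N (\<lambda>p. frechet_derivative g (at p) v)" for v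
    by (rule Suc.IH[of "\<lambda>p. frechet_derivative f (at p) v"]) (use Suc.prems fd in auto)
  ultimately show ?case
    by simp
qed

lemma Ck_on_SucD: "Ck_on (Suc k) N f \<Longrightarrow> Ck_on k N f"
proof (induction k arbitrary: f)
  case 0
  then show ?case
    by (simp add: continuous_at_imp_continuous_on differentiable_imp_continuous_within)
next
  case (Suc k)
  then show ?case
    by (metis Ck_on.simps(2))
qed

text \<open>This admits any explicit derivative in place of \<open>frechet_derivative\<close>, so
  the usual differentiation rules can drive the inductions below.\<close>

lemma Ck_on_SucI:
  assumes "open N" "\<And>p. p \<in> N \<Longrightarrow> (f has_derivative f' p) (at p)"
    "\<And>v. Ck_on k N (\<lambda>p. f' p v)"
  shows "Ck_on (Suc k) N f"
proof -
  have fd: "frechet_derivative f (at p) = f' p" if "p \<in> N" for p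
    using frechet_derivative_at[OF assms(2)[OF that]] by simp
  have "Ck_on k N (\<lambda>p. frechet_derivative f (at p) v)" for v
    by (rule Ck_on_cong[OF assms(1) _ assms(3)[of v]]) (simp add: fd)
  then show ?thesis
    using assms(2) by (auto simp: differentiable_def)
qed

lemma Ck_on_frechet:
  assumes "Ck_on (Suc k) N f" "p \<in> N"
  shows "(f has_derivative frechet_derivative f (at p)) (at p)"
  using assms frechet_derivative_works by auto

lemma Ck_on_const: "Ck_on k N (\<lambda>p. c)"
  by (induction k arbitrary: c) auto

lemma Ck_on_add:
  assumes "open N" "Ck_on k N f" "Ck_on k N g"
  shows "Ck_on k N (\<lambda>p. f p + g p)"
  using assms(2,3)
proof (induction k arbitrary: f g)
  case 0
  then show ?case
    by (simp add: continuous_on_add continuous_on_mult)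
next
  case (Suc k)
  show ?case
    by (rule Ck_on_SucI[OF assms(1)
          has_derivative_add[OF Ck_on_frechet[OF Suc.prems(1)] Ck_on_frechet[OF Suc.prems(2)]]])
      (use Suc in auto)
qed

lemma Ck_on_mult:
  assumes "open N" "Ck_on k N f" "Ck_on k N g"
  shows "Ck_on k N (\<lambda>p. f p * g p)"
  using assms(2,3)
proof (induction k arbitrary: f g)
  case 0
  then show ?case
    by (simp add: continuous_on_add continuous_on_mult)
next
  case (Suc k)
  show ?case
    by (rule Ck_on_SucI[OF assms(1)
          has_derivative_mult[OF Ck_on_frechet[OF Suc.prems(1)] Ck_on_frechet[OF Suc.prems(2)]]])
      (use Suc.prems Suc.prems[THEN Ck_on_SucD] in
        \<open>auto intro!: Ck_on_add[OF assms(1)] Suc.IH\<close>)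
qed

text \<open>The derivative of \<open>inverse f\<close> again contains \<open>inverse f\<close>; the
  induction hypothesis, applied to \<open>f\<close> one class lower, controls that factor.\<close>

lemma Ck_on_inverse:
  assumes "open N" "Ck_on k N f" "\<And>p. p \<in> N \<Longrightarrow> f p \<noteq> 0"
  shows "Ck_on k N (\<lambda>p. inverse (f p))"
  using assms(2,3)
proof (induction k arbitrary: f)
  case 0
  then show ?case
    by (simp add: continuous_on_inverse)
next
  case (Suc k)
  have "Ck_on k N (\<lambda>p. inverse (f p))"
    by (rule Suc.IH[OF Ck_on_SucD[OF Suc.prems(1)] Suc.prems(2)])
  then have "Ck_on k N (\<lambda>p. (- 1) * (inverse (f p) * frechet_derivative f (at p) v * inverse (f p)))" for v
    using Suc.prems(1) by (intro Ck_on_mult[OF assms(1)] Ck_on_const) auto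
  then show ?case
    by (intro Ck_on_SucI[OF assms(1) Deriv.has_derivative_inverse[OF Suc.prems(2) Ck_on_frechet[OF Suc.prems(1)]]])
      auto
qed

lemma Ck_on_bounded_linear:
  assumes "open N" "bounded_linear f"
  shows "Ck_on k N f"
proof (cases k)
  case 0
  then show ?thesis
    using assms(2) by (simp add: linear_continuous_on)
next
  case (Suc n)
  show ?thesis
    unfolding Suc
    by (rule Ck_on_SucI[OF assms(1) bounded_linear_imp_has_derivative[OF assms(2)]]) (rule Ck_on_const)
qed

section \<open>The Kaehler-Berndt metric\<close>

lemma vector_4:
  "(vector [x, y, z, w] :: ('a::zero)^4) $ 1 = x"
  "(vector [x, y, z, w] :: ('a::zero)^4) $ 2 = y"
  "(vector [x, y, z, w] :: ('a::zero)^4) $ 3 = z"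
  "(vector [x, y, z, w] :: ('a::zero)^4) $ 4 = w"
  unfolding vector_def by simp_all

text \<open>Each 2 by 2 block of the matrix is a multiple of the identity, so the metric is a
  combination of the real inner products of the two complex components.\<close>

lemma KB_metric_eq:
  "KB_metric p X Y =
    ((Im (fst p) + (Im (snd p))\<^sup>2) / Im (fst p) ^ 3 * (fst X \<bullet> fst Y)
      - Im (snd p) / (Im (fst p))\<^sup>2 * (fst X \<bullet> snd Y + snd X \<bullet> fst Y)
      + 1 / Im (fst p) * (snd X \<bullet> snd Y)) / 2"
  by (cases p; cases X; cases Y)
    (simp add: KB_metric_def real_coords_def KB_matrix_def Let_def inner_vec_def
      matrix_vector_mult_def sum_4 vector_4 inner_complex_def algebra_simps
      add_divide_distrib diff_divide_distrib)

lemma SJ_J_simps [simp]: "fst (SJ_J X) = \<i> * fst X" "snd (SJ_J X) = \<i> * snd X"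
  by (simp_all add: SJ_J_def split_beta)

lemma open_SJ: "open SJ"
proof -
  have "SJ = {p. Im (fst p) > 0}"
    by (auto simp: SJ_def)
  moreover have "open {p::complex \<times> complex. Im (fst p) > 0}"
    by (intro open_Collect_less continuous_intros)
  ultimately show ?thesis
    by simp
qed

lemma SJ_iff: "p \<in> SJ \<longleftrightarrow> Im (fst p) > 0"
  by (auto simp: SJ_def)

lemma KB_metric_pos:
  assumes "p \<in> SJ" "X \<noteq> 0"
  shows "KB_metric p X X > 0"
proof -
  define v y where "v = Im (fst p)" and "y = Im (snd p)"
  have v: "v > 0"
    using assms by (simp add: v_def SJ_iff)
  \<comment> \<open>Completing the square in the second component shows positivity.\<close>
  have eq: "KB_metric p X X = ((norm (fst X))\<^sup>2 / v\<^sup>2 + (norm ((y / v) *\<^sub>R fst X - snd X))\<^sup>2 / v) / 2"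
    unfolding KB_metric_eq v_def[symmetric] y_def[symmetric] dot_square_norm[symmetric]
    using v by (simp add: inner_diff inner_commute field_simps power2_eq_square power3_eq_cube)
  show ?thesis
  proof (cases "fst X = 0")
    case True
    then have "snd X \<noteq> 0"
      using assms by (simp add: prod_eq_iff)
    then show ?thesis
      unfolding eq using True v by simp
  next
    case False
    then have "(norm (fst X))\<^sup>2 / v\<^sup>2 > 0"
      using v by simp
    moreover have "(norm ((y / v) *\<^sub>R fst X - snd X))\<^sup>2 / v \<ge> 0"
      using v by simp
    ultimately show ?thesis
      unfolding eq by simp
  qed
qed

lemma KB_metric_diff_left: "KB_metric p (X - Y) Z = KB_metric p X Z - KB_metric p Y Z"
  by (simp add: KB_metric_eq inner_diff algebra_simps add_divide_distrib diff_divide_distrib)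

lemma KB_metric_commute: "KB_metric p X Y = KB_metric p Y X"
  by (simp add: KB_metric_eq inner_commute)

lemma KB_metric_nondegenerate:
  assumes "p \<in> SJ" "\<And>w. KB_metric p X w = KB_metric p Y w"
  shows "X = Y"
  using KB_metric_pos[OF assms(1), of "X - Y"] assms(2)[of "X - Y"]
  by (force simp: KB_metric_diff_left)

lemma KB_form_nondegenerate:
  assumes "p \<in> SJ" "\<And>w. KB_form p X w = KB_form p Y w"
  shows "X = Y"
proof -
  have "SJ_J X = SJ_J Y"
    using assms by (intro KB_metric_nondegenerate[OF assms(1)]) (simp add: kaehler_form_def)
  then show ?thesis
    by (auto simp: SJ_J_def prod_eq_iff split_beta)
qed

section \<open>Hamiltonian vectors and derivatives of the metric\<close>

text \<open>Nondegeneracy makes the definite description meaningful: any solution of the defining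
  equation is the Hamiltonian vector.\<close>

lemma hamiltonian_field_KB_eqI:
  assumes "p \<in> SJ" "\<And>w. KB_form p X w = frechet_derivative f (at p) w"
  shows "hamiltonian_field KB_form f p = X"
  unfolding hamiltonian_field_def
  using assms(2) by (intro the_equality KB_form_nondegenerate[OF assms(1)]) metis+

text \<open>The solution \<open>X\<close> of \<open>\<omega>\<^sub>p(X, \<cdot>) = l\<close>, namely \<open>- J\<close> applied to the gradient; the
  coefficients are those of the inverse of the metric.\<close>

definition ham_vec :: "complex \<times> complex \<Rightarrow> (complex \<times> complex \<Rightarrow> real) \<Rightarrow> complex \<times> complex"
  where "ham_vec p l = (let v = Im (fst p); y = Im (snd p) in
    (Complex (2 * (v\<^sup>2 * l (\<i>, 0) + v * y * l (0, \<i>))) (- 2 * (v\<^sup>2 * l (1, 0) + v * y * l (0, 1))),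
     Complex (2 * (v * y * l (\<i>, 0) + (v + y\<^sup>2) * l (0, \<i>)))
       (- 2 * (v * y * l (1, 0) + (v + y\<^sup>2) * l (0, 1)))))"

lemma linear_complex_pair:
  fixes l :: "complex \<times> complex \<Rightarrow> real"
  assumes "linear l"
  shows "l w = Re (fst w) * l (1, 0) + Im (fst w) * l (\<i>, 0) + Re (snd w) * l (0, 1) + Im (snd w) * l (0, \<i>)"
proof -
  have "w = Re (fst w) *\<^sub>R (1, 0) + Im (fst w) *\<^sub>R (\<i>, 0) + Re (snd w) *\<^sub>R (0, 1) + Im (snd w) *\<^sub>R (0, \<i>)"
    by (auto simp: prod_eq_iff complex_eq_iff)
  from arg_cong[OF this, of l] show ?thesis
    by (simp only: linear_add[OF assms] linear_cmul[OF assms] real_scaleR_def)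
qed

lemma KB_form_ham_vec:
  assumes "p \<in> SJ" "linear l"
  shows "KB_form p (ham_vec p l) w = l w"
  using assms(1)
  by (subst linear_complex_pair[OF assms(2)])
    (simp add: kaehler_form_def KB_metric_eq ham_vec_def Let_def inner_complex_def SJ_iff
      field_simps power2_eq_square power3_eq_cube)

lemma hamiltonian_field_KB:
  assumes "p \<in> SJ" "f differentiable (at p)"
  shows "hamiltonian_field KB_form f p = ham_vec p (frechet_derivative f (at p))"
  using assms by (intro hamiltonian_field_KB_eqI KB_form_ham_vec linear_frechet_derivative)

text \<open>The derivative at \<open>p\<close> in direction \<open>h\<close> of the coefficients of the metric, applied to
  the constant fields \<open>X\<close> and \<open>Y\<close>.\<close>

definition KB_metric_deriv ::
    "complex \<times> complex \<Rightarrow> complex \<times> complex \<Rightarrow> complex \<times> complex \<Rightarrow> complex \<times> complex \<Rightarrow> real"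
  where "KB_metric_deriv p h X Y = (let v = Im (fst p); y = Im (snd p); b = Im (fst h); c = Im (snd h) in
    ((2 * y * v * c - (2 * v + 3 * y\<^sup>2) * b) / v ^ 4 * (fst X \<bullet> fst Y)
      + (2 * y * b - v * c) / v ^ 3 * (fst X \<bullet> snd Y + snd X \<bullet> fst Y)
      - b / v\<^sup>2 * (snd X \<bullet> snd Y)) / 2)"

text \<open>The arguments vary with the point because the rule is needed for
  \<open>\<omega>(X, w) = g(J X, w)\<close> with a nonconstant field \<open>X\<close>.\<close>

lemma has_derivative_KB_metric:
  assumes "p \<in> SJ" "(A has_derivative A') (at p)" "(B has_derivative B') (at p)"
  shows "((\<lambda>q. KB_metric q (A q) (B q)) has_derivative
    (\<lambda>h. KB_metric_deriv p h (A p) (B p) + KB_metric p (A' h) (B p) + KB_metric p (A p) (B' h))) (at p)"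
proof -
  have v: "Im (fst p) > 0"
    using assms(1) by (simp add: SJ_iff)
  have c1: "((\<lambda>q::complex \<times> complex. (Im (fst q) + (Im (snd q))\<^sup>2) / Im (fst q) ^ 3) has_derivative
      (\<lambda>h. (2 * Im (snd p) * Im (fst p) * Im (snd h)
        - (2 * Im (fst p) + 3 * (Im (snd p))\<^sup>2) * Im (fst h)) / Im (fst p) ^ 4)) (at p)"
    using v by (auto intro!: derivative_eq_intros
        simp: fun_eq_iff field_simps power2_eq_square power3_eq_cube power4_eq_xxxx)
  have c2: "((\<lambda>q::complex \<times> complex. Im (snd q) / (Im (fst q))\<^sup>2) has_derivative
      (\<lambda>h. - ((2 * Im (snd p) * Im (fst h) - Im (fst p) * Im (snd h)) / Im (fst p) ^ 3))) (at p)"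
    using v by (auto intro!: derivative_eq_intros
        simp: fun_eq_iff field_simps power2_eq_square power3_eq_cube)
  have c3: "((\<lambda>q::complex \<times> complex. 1 / Im (fst q)) has_derivative
      (\<lambda>h. - (Im (fst h) / (Im (fst p))\<^sup>2))) (at p)"
    using v by (auto intro!: derivative_eq_intros simp: fun_eq_iff field_simps power2_eq_square)
  have c4: "((\<lambda>q. F (A q) \<bullet> G (B q)) has_derivative (\<lambda>h. F (A p) \<bullet> G (B' h) + F (A' h) \<bullet> G (B p))) (at p)"
    if "bounded_linear F" "bounded_linear G" for F G :: "complex \<times> complex \<Rightarrow> complex"
    by (rule has_derivative_inner[OF bounded_linear.has_derivative[OF that(1) assms(2)]
          bounded_linear.has_derivative[OF that(2) assms(3)]])
  show ?thesis
    unfolding KB_metric_eq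
    by (rule has_derivative_eq_rhs,
        (rule bounded_linear.has_derivative[OF bounded_linear_divide] has_derivative_add has_derivative_diff has_derivative_mult
        c1 c2 c3 c4[OF bounded_linear_fst bounded_linear_fst] c4[OF bounded_linear_fst bounded_linear_snd]
        c4[OF bounded_linear_snd bounded_linear_fst] c4[OF bounded_linear_snd bounded_linear_snd])+)
      (simp add: fun_eq_iff KB_metric_deriv_def Let_def algebra_simps add_divide_distrib diff_divide_distrib)
qed

text \<open>This is d\<omega> = 0 on the constant fields \<open>t\<close>, \<open>X\<close>,
  \<open>w\<close>, rearranged by means of \<omega>(t, X) = - \<omega>(X, t).\<close>

lemma KB_form_closed:
  assumes "p \<in> SJ"
  shows "KB_metric_deriv p t (SJ_J X) w - KB_metric_deriv p w (SJ_J X) t = KB_metric_deriv p X (SJ_J t) w"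
  using assms
  by (simp add: KB_metric_deriv_def Let_def inner_complex_def SJ_iff
      field_simps power2_eq_square power3_eq_cube power4_eq_xxxx)

section \<open>Kaehler fields are holomorphic\<close>

text \<open>By \<open>ham_vec\<close> the components of the field are polynomials in the coordinates
  and the first partial derivatives of \<open>f\<close>, which are differentiable.\<close>

lemma hamiltonian_field_KB_differentiable:
  assumes "Ck_on 2 SJ f" "p \<in> SJ"
  shows "hamiltonian_field KB_form f differentiable (at p)"
proof -
  have df: "\<And>q. q \<in> SJ \<Longrightarrow> f differentiable (at q)"
    and ddf: "\<And>v. (\<lambda>q. frechet_derivative f (at q) v) differentiable (at p)"
    using assms(1)[unfolded numeral_2_eq_2 Ck_on.simps] assms(2) by blast+
  have d: "((\<lambda>q. frechet_derivative f (at q) v) has_derivative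
      frechet_derivative (\<lambda>q. frechet_derivative f (at q) v) (at p)) (at p)" for v
    using ddf frechet_derivative_works by blast
  have "(\<lambda>q. ham_vec q (frechet_derivative f (at q))) differentiable (at p)"
    unfolding ham_vec_def Let_def Complex_eq differentiable_def
    by (rule exI) (rule derivative_intros d refl)+
  then obtain E where "((\<lambda>q. ham_vec q (frechet_derivative f (at q))) has_derivative E) (at p)"
    by (auto simp: differentiable_def)
  then have "(hamiltonian_field KB_form f has_derivative E) (at p)"
    by (rule has_derivative_transform_within_open[OF _ open_SJ assms(2)]) (simp add: hamiltonian_field_KB df)
  then show ?thesis
    by (auto simp: differentiable_def)
qed

lemma KB_metric_zero [simp]: "KB_metric p 0 X = 0" "KB_metric p X 0 = 0"
  by (simp_all add: KB_metric_eq)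

lemma KB_metric_SJ_J: "KB_metric p (SJ_J X) Y = - KB_metric p X (SJ_J Y)"
  by (simp add: KB_metric_eq inner_complex_def algebra_simps add_divide_distrib diff_divide_distrib)

lemma bounded_linear_SJ_J: "bounded_linear SJ_J"
  unfolding SJ_J_def split_beta by (intro bounded_linear_intros)

lemma frechet_derivative_KB_metric:
  assumes "p \<in> SJ"
  shows "frechet_derivative (\<lambda>q. KB_metric q v w) (at p) h = KB_metric_deriv p h v w"
proof -
  have "((\<lambda>q. KB_metric q v w) has_derivative (\<lambda>h. KB_metric_deriv p h v w)) (at p)"
    using has_derivative_KB_metric[OF assms has_derivative_const has_derivative_const, of v w] by simp
  from fun_cong[OF frechet_derivative_at[OF this], of h] show ?thesis
    by simp
qed

text \<open>The Lie derivatives of the metric and, since second derivatives commute and \<open>\<omega>\<close> is closed,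
  of \<open>\<omega>\<close> along a Hamiltonian Killing field vanish; comparing the two shows that its derivative
  commutes with \<open>J\<close>.\<close>

lemma kaehler_field_derivative:
  assumes "f \<in> kaehler_functions SJ KB_metric SJ_J" "p \<in> SJ"
  defines "X \<equiv> hamiltonian_field KB_form f"
  obtains D where "(X has_derivative D) (at p)" "\<And>t. D (SJ_J t) = SJ_J (D t)"
    "\<And>v w. KB_metric_deriv p (X p) v w + KB_metric p (D v) w + KB_metric p v (D w) = 0"
proof -
  have C2: "Ck_on 2 SJ f"
    and lie: "\<And>v w. lie_derivative_metric X KB_metric p v w = 0"
    using assms by (auto simp: kaehler_functions_def smooth_fun_on_def X_def)
  then have df: "\<And>q. q \<in> SJ \<Longrightarrow> f differentiable (at q)"
    by (simp add: numeral_2_eq_2)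
  define D where "D = frechet_derivative X (at p)"
  have D: "(X has_derivative D) (at p)"
    using hamiltonian_field_KB_differentiable[OF C2 assms(2)] frechet_derivative_works
    unfolding X_def D_def by blast
  have L: "KB_metric_deriv p (X p) v w + KB_metric p (D v) w + KB_metric p v (D w) = 0" for v w
    using lie[of v w] by (simp add: lie_derivative_metric_def D_def frechet_derivative_KB_metric assms(2))
  \<comment> \<open>The defining equation holds on all of \<open>SJ\<close>, so it can be
    differentiated; this expresses the second derivatives of \<open>f\<close> through
    \<open>D\<close>.\<close>
  have form: "KB_metric q (SJ_J (X q)) w = frechet_derivative f (at q) w" if "q \<in> SJ" for q w
    using KB_form_ham_vec[OF that linear_frechet_derivative[OF df[OF that]]]
      hamiltonian_field_KB[OF that df[OF that]]
    by (simp add: X_def kaehler_form_def)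
  have "frechet_derivative (\<lambda>q. frechet_derivative f (at q) w) (at p) t
      = KB_metric_deriv p t (SJ_J (X p)) w + KB_metric p (SJ_J (D t)) w" for t w
  proof -
    have "((\<lambda>q. KB_metric q (SJ_J (X q)) w) has_derivative
        (\<lambda>h. KB_metric_deriv p h (SJ_J (X p)) w + KB_metric p (SJ_J (D h)) w)) (at p)"
      using has_derivative_KB_metric[OF assms(2)
          bounded_linear.has_derivative[OF bounded_linear_SJ_J D] has_derivative_const, of w] by simp
    then have "((\<lambda>q. frechet_derivative f (at q) w) has_derivative
        (\<lambda>h. KB_metric_deriv p h (SJ_J (X p)) w + KB_metric p (SJ_J (D h)) w)) (at p)"
      by (rule has_derivative_transform_within_open[OF _ open_SJ assms(2)]) (simp add: form)
    from fun_cong[OF frechet_derivative_at[OF this], of t] show ?thesis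
      by simp
  qed
  then have sym: "KB_metric_deriv p t (SJ_J (X p)) w + KB_metric p (SJ_J (D t)) w
      = KB_metric_deriv p w (SJ_J (X p)) t + KB_metric p (SJ_J (D w)) t" for t w
    using second_frechet_derivative_symmetric[OF open_SJ assms(2) C2, of w t] by simp
  have "D (SJ_J t) = SJ_J (D t)" for t
  proof (rule KB_metric_nondegenerate[OF assms(2)])
    fix w
    \<comment> \<open>Symmetry of second derivatives and closedness say that \<omega> is invariant,
      the Killing equation at \<open>SJ_J t\<close> and \<open>w\<close> that \<open>g\<close> is.
      Both contain the derivative of the metric along \<open>X p\<close>; eliminating it leaves the
      claim.\<close>
    show "KB_metric p (D (SJ_J t)) w = KB_metric p (SJ_J (D t)) w"
      using sym[of t w] KB_form_closed[OF assms(2), of t "X p" w] L[of "SJ_J t" w]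
        KB_metric_SJ_J[of p "D w" t] KB_metric_commute[of p "D w" "SJ_J t"]
      by linarith
  qed
  with D L show thesis
    by (intro that)
qed

text \<open>The last three equations are the entries \<open>(z, z)\<close>, \<open>(\<tau>, \<tau>)\<close> and \<open>(\<tau>, z)\<close> of the
  Hermitian matrix that represents the Lie derivative of the metric, with denominators cleared.\<close>

lemma kaehler_field_equations:
  fixes \<tau> z :: complex
  assumes "f \<in> kaehler_functions SJ KB_metric SJ_J" "Im \<tau> > 0"
  defines "X \<equiv> hamiltonian_field KB_form f" and "v \<equiv> Im \<tau>" and "y \<equiv> Im z"
  obtains P Q R S where
    "((\<lambda>t. fst (X (t, z))) has_field_derivative P) (at \<tau>)"
    "((\<lambda>t. fst (X (\<tau>, t))) has_field_derivative Q) (at z)"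
    "((\<lambda>t. snd (X (t, z))) has_field_derivative R) (at \<tau>)"
    "((\<lambda>t. snd (X (\<tau>, t))) has_field_derivative S) (at z)"
    "2 * Re (of_real v * S - of_real y * Q) = Im (fst (X (\<tau>, z)))"
    "2 * Re (of_real (v * (v + y\<^sup>2)) * P - of_real (y * v\<^sup>2) * R)
      = (2 * v + 3 * y\<^sup>2) * Im (fst (X (\<tau>, z))) - 2 * y * v * Im (snd (X (\<tau>, z)))"
    "of_real (2 * y * Im (fst (X (\<tau>, z))) - v * Im (snd (X (\<tau>, z))))
      - of_real (v * y) * cnj P + of_real (v\<^sup>2) * cnj R + of_real (v + y\<^sup>2) * Q - of_real (v * y) * S = 0"
proof -
  have v: "v > 0" and p: "(\<tau>, z) \<in> SJ"
    using assms by (simp_all add: SJ_iff)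
  obtain D where D: "(X has_derivative D) (at (\<tau>, z))" "\<And>t. D (SJ_J t) = SJ_J (D t)"
    and L: "\<And>V W. KB_metric_deriv (\<tau>, z) (X (\<tau>, z)) V W
      + KB_metric (\<tau>, z) (D V) W + KB_metric (\<tau>, z) V (D W) = 0"
    using kaehler_field_derivative[OF assms(1) p] unfolding X_def by metis
  have lin: "linear D"
    using D(1) has_derivative_linear by blast
  \<comment> \<open>Commuting with \<open>SJ_J\<close> turns real linearity into complex linearity,
    so \<open>D\<close> is a complex 2 by 2 matrix with columns \<open>(P, R)\<close> and
    \<open>(Q, S)\<close>.\<close>
  have smult: "D (a * b, a * c) = (a * fst (D (b, c)), a * snd (D (b, c)))" for a b c
  proof -
    have "(a * b, a * c) = Re a *\<^sub>R (b, c) + Im a *\<^sub>R SJ_J (b, c)"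
      by (simp add: SJ_J_def complex_eq_iff)
    then have "D (a * b, a * c) = Re a *\<^sub>R D (b, c) + Im a *\<^sub>R SJ_J (D (b, c))"
      by (simp only: linear_add[OF lin] linear_cmul[OF lin] D(2))
    then show ?thesis
      by (simp add: prod_eq_iff complex_eq_iff)
  qed
  define P Q R S where "P = fst (D (1, 0))" and "Q = fst (D (0, 1))"
    and "R = snd (D (1, 0))" and "S = snd (D (0, 1))"
  have D1: "D (a, 0) = (a * P, a * R)" for a
    using smult[of a 1 0] by (simp add: P_def R_def)
  have D2: "D (0, a) = (a * Q, a * S)" for a
    using smult[of a 0 1] by (simp add: Q_def S_def)
  have "((\<lambda>t. X (t, z)) has_derivative (\<lambda>h. D (h, 0))) (at \<tau>)"
    using has_derivative_compose[OF has_derivative_Pair[OF has_derivative_ident has_derivative_const] D(1)] by simp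
  note h1 = this[unfolded D1]
  have "((\<lambda>t. X (\<tau>, t)) has_derivative (\<lambda>h. D (0, h))) (at z)"
    using has_derivative_compose[OF has_derivative_Pair[OF has_derivative_const has_derivative_ident], of X D]
      D(1) by simp
  note h2 = this[unfolded D2]
  have vne: "v \<noteq> 0"
    using v by simp
  note expand = KB_metric_deriv_def KB_metric_eq Let_def inner_complex_def D1 D2
    v_def[symmetric] y_def[symmetric]
  show thesis
  proof
    show "((\<lambda>t. fst (X (t, z))) has_field_derivative P) (at \<tau>)"
      "((\<lambda>t. fst (X (\<tau>, t))) has_field_derivative Q) (at z)"
      "((\<lambda>t. snd (X (t, z))) has_field_derivative R) (at \<tau>)"
      "((\<lambda>t. snd (X (\<tau>, t))) has_field_derivative S) (at z)"
      using has_derivative_fst[OF h1] has_derivative_fst[OF h2] has_derivative_snd[OF h1] has_derivative_snd[OF h2]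
      by (simp_all add: has_field_derivative_def mult_commute_abs)
    let ?L = "\<lambda>V W. KB_metric_deriv (\<tau>, z) (X (\<tau>, z)) V W
      + KB_metric (\<tau>, z) (D V) W + KB_metric (\<tau>, z) V (D W)"
    note powers = power2_eq_square power3_eq_cube power4_eq_xxxx
    have "2 * Re (of_real v * S - of_real y * Q) - Im (fst (X (\<tau>, z))) = 2 * v ^ 2 * ?L (0, 1) (0, 1)"
      using vne by (simp add: expand field_simps powers)
    then show "2 * Re (of_real v * S - of_real y * Q) = Im (fst (X (\<tau>, z)))"
      unfolding L by simp
    have "2 * Re (of_real (v * (v + y\<^sup>2)) * P - of_real (y * v\<^sup>2) * R)
      - ((2 * v + 3 * y\<^sup>2) * Im (fst (X (\<tau>, z))) - 2 * y * v * Im (snd (X (\<tau>, z))))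
      = 2 * v ^ 4 * ?L (1, 0) (1, 0)"
      using vne by (simp add: expand field_simps powers)
    then show "2 * Re (of_real (v * (v + y\<^sup>2)) * P - of_real (y * v\<^sup>2) * R)
      = (2 * v + 3 * y\<^sup>2) * Im (fst (X (\<tau>, z))) - 2 * y * v * Im (snd (X (\<tau>, z)))"
      unfolding L by simp
    let ?C = "of_real (2 * y * Im (fst (X (\<tau>, z))) - v * Im (snd (X (\<tau>, z))))
      - of_real (v * y) * cnj P + of_real (v\<^sup>2) * cnj R + of_real (v + y\<^sup>2) * Q - of_real (v * y) * S"
    \<comment> \<open>The real and imaginary parts of the off-diagonal entry come from testing
      \<open>(1, 0)\<close> against \<open>(0, 1)\<close> and against
      \<open>(0, \<i>)\<close>.\<close>
    have "Re ?C = 2 * v ^ 3 * ?L (1, 0) (0, 1)"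
      using vne by (simp add: expand field_simps powers)
    moreover have "Im ?C = - 2 * v ^ 3 * ?L (1, 0) (0, \<i>)"
      using vne by (simp add: expand field_simps powers)
    ultimately show "?C = 0"
      unfolding L by (simp add: complex_eq_iff)
  qed
qed

section \<open>Holomorphic solutions of the Killing equations\<close>

text \<open>The tool for differentiating an identity on an open set. Using the directions 1 and \<i>
  of the real derivative separates its holomorphic and antiholomorphic parts.\<close>

lemma has_derivative_of_zero:
  assumes "open U" "z \<in> U" "\<And>w. w \<in> U \<Longrightarrow> F w = 0" "(F has_derivative F') (at z)"
  shows "F' h = 0"
proof -
  have "((\<lambda>_. 0) has_derivative F') (at z)"
    by (rule has_derivative_transform_within_open[OF assms(4,1,2)]) (simp add: assms(3))
  then have "F' = (\<lambda>_. 0)"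
    by (rule has_derivative_unique) simp
  then show ?thesis
    by simp
qed

lemma eq_of_deriv_eq:
  assumes "convex U" "a \<in> U" "F a = G a"
    "\<And>z. z \<in> U \<Longrightarrow> (F has_field_derivative f z) (at z)"
    "\<And>z. z \<in> U \<Longrightarrow> (G has_field_derivative f z) (at z)"
    "z \<in> U"
  shows "F z = (G z :: complex)"
proof -
  have "((\<lambda>z. F z - G z) has_field_derivative 0) (at w within U)" if "w \<in> U" for w
    using DERIV_diff[OF assms(4,5)[OF that]] has_field_derivative_at_within by fastforce
  then obtain c where "\<And>w. w \<in> U \<Longrightarrow> F w - G w = c"
    using has_field_derivative_zero_constant[OF assms(1)] by metis
  then show ?thesis
    using assms(2,3,6) by (metis cancel_comm_monoid_add_class.diff_cancel eq_iff_diff_eq_0)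
qed

lemma has_derivative_deriv:
  assumes "F holomorphic_on U" "open U" "z \<in> U"
  shows "(F has_derivative (\<lambda>w. deriv F z * w)) (at z)"
  using holomorphic_derivI[OF assms, of UNIV] by (simp add: has_field_derivative_def)

text \<open>Cauchy-Riemann: \<open>Im (F' * w)\<close> vanishes for \<open>w = 1\<close> and
  \<open>w = \<i>\<close>, which are the imaginary and real parts of the derivative.\<close>

lemma real_valued_deriv_zero:
  assumes "F holomorphic_on U" "open U" "\<And>w. w \<in> U \<Longrightarrow> Im (F w) = 0" "z \<in> U"
  shows "deriv F z = 0"
proof -
  have "((\<lambda>w. Im (F w)) has_derivative (\<lambda>w. Im (deriv F z * w))) (at z)"
    by (intro derivative_intros has_derivative_deriv[OF assms(1,2,4)])
  from has_derivative_of_zero[OF assms(2,4,3) this] have "Im (deriv F z * w) = 0" for w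
    by simp
  from this[of 1] this[of \<i>] show ?thesis
    by (simp add: complex_eq_iff)
qed

lemma affine_of_deriv_const:
  assumes "convex U" "open U" "F holomorphic_on U" "\<And>z. z \<in> U \<Longrightarrow> deriv F z = c"
  obtains d where "\<And>z. z \<in> U \<Longrightarrow> F z = c * z + d"
proof (cases "U = {}")
  case False
  then obtain a where a: "a \<in> U"
    by blast
  have "F z = c * z + (F a - c * a)" if "z \<in> U" for z
    by (rule eq_of_deriv_eq[OF assms(1) a, of _ _ "\<lambda>_. c"])
      (use that holomorphic_derivI[OF assms(3,2), of _ UNIV] assms(4) in
        \<open>auto intro!: derivative_eq_intros\<close>)
  then show thesis
    by (rule that)
qed (use that in auto)

text \<open>Subtracting the leading monomial reduces to the previous degree; the cubic case below
  works in the same way.\<close>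

lemma quadratic_of_deriv_affine:
  assumes "convex U" "open U" "F holomorphic_on U" "\<And>z. z \<in> U \<Longrightarrow> deriv F z = c * z + e"
  obtains d where "\<And>z. z \<in> U \<Longrightarrow> F z = c / 2 * z\<^sup>2 + e * z + d"
proof -
  have D: "((\<lambda>z. F z - c / 2 * z\<^sup>2) has_field_derivative e) (at z)" if "z \<in> U" for z
    using holomorphic_derivI[OF assms(3,2) that, of UNIV] assms(4)[OF that]
    by (auto intro!: derivative_eq_intros)
  then have hol: "(\<lambda>z. F z - c / 2 * z\<^sup>2) holomorphic_on U"
    using assms(2) holomorphic_on_open by blast
  obtain d where "\<And>z. z \<in> U \<Longrightarrow> F z - c / 2 * z\<^sup>2 = e * z + d"
    using affine_of_deriv_const[OF assms(1,2) hol DERIV_imp_deriv[OF D]] by blast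
  then show thesis
    by (intro that[of d]) (simp add: algebra_simps)
qed

lemma cubic_of_deriv_quadratic:
  assumes "convex U" "open U" "F holomorphic_on U" "\<And>z. z \<in> U \<Longrightarrow> deriv F z = b * z\<^sup>2 + c * z + e"
  obtains d where "\<And>z. z \<in> U \<Longrightarrow> F z = b / 3 * z ^ 3 + c / 2 * z\<^sup>2 + e * z + d"
proof -
  have D: "((\<lambda>z. F z - b / 3 * z ^ 3) has_field_derivative c * z + e) (at z)" if "z \<in> U" for z
    using holomorphic_derivI[OF assms(3,2) that, of UNIV] assms(4)[OF that]
    by (auto intro!: derivative_eq_intros)
  then have hol: "(\<lambda>z. F z - b / 3 * z ^ 3) holomorphic_on U"
    using assms(2) holomorphic_on_open by blast
  obtain d where "\<And>z. z \<in> U \<Longrightarrow> F z - b / 3 * z ^ 3 = c / 2 * z\<^sup>2 + e * z + d"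
    using quadratic_of_deriv_affine[OF assms(1,2) hol DERIV_imp_deriv[OF D]] by blast
  then show thesis
    by (intro that[of d]) (simp add: algebra_simps)
qed

text \<open>The hypothesis \<open>eq\<close> is the \<open>(z, z)\<close> Killing equation on a fibre \<open>\<tau> = const\<close>. Differentiating it
  twice, along \<open>1\<close> and \<open>\<i>\<close>, and using the Cauchy-Riemann equations forces \<open>deriv (deriv g)\<close> to be
  real, hence constant.\<close>

lemma fiber_equation_solution:
  fixes g k :: "complex \<Rightarrow> complex" and v :: real
  assumes g: "g holomorphic_on UNIV" and k: "k holomorphic_on UNIV" and v: "v \<noteq> 0"
    and eq: "\<And>z. 2 * Re (of_real v * deriv k z - of_real (Im z) * deriv g z) = Im (g z)"
  obtains c \<alpha> \<beta> \<gamma> \<delta> where "Im c = 0"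
    "\<And>z. g z = c * z\<^sup>2 + \<alpha> * z + \<beta>"
    "\<And>z. k z = - (\<i> * c / (2 * of_real v)) * z ^ 3
      + (of_real (Im \<alpha>) - 3 * \<i> * of_real (Re \<alpha>)) / (4 * of_real v) * z\<^sup>2 + \<gamma> * z + \<delta>"
proof -
  define h where "h = (\<lambda>z. of_real v * deriv k z)"
  define g1 g2 g3 h1 h2 where "g1 = deriv g" and "g2 = deriv g1" and "g3 = deriv g2"
    and "h1 = deriv h" and "h2 = deriv h1"
  have hol: "g1 holomorphic_on UNIV" "g2 holomorphic_on UNIV" "h holomorphic_on UNIV" "h1 holomorphic_on UNIV"
    by (auto simp: g1_def g2_def h_def h1_def intro!: holomorphic_deriv holomorphic_intros g k)
  note d = has_derivative_deriv[OF _ open_UNIV UNIV_I]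
  note D = d[OF g, folded g1_def] d[OF hol(1), folded g2_def] d[OF hol(2), folded g3_def]
    d[OF hol(3), folded h1_def] d[OF hol(4), folded h2_def]
  note zero = has_derivative_of_zero[OF open_UNIV UNIV_I]
  have 1: "2 * (h1 z - of_real (Im z) * g2 z) = of_real (Im (g1 z)) - 3 * \<i> * of_real (Re (g1 z))" for z
  proof -
    have "((\<lambda>z. 2 * Re (h z - of_real (Im z) * g1 z) - Im (g z)) has_derivative
      (\<lambda>w. 2 * Re (h1 z * w - (of_real (Im z) * (g2 z * w) + of_real (Im w) * g1 z)) - Im (g1 z * w))) (at z)"
      by (intro derivative_intros D)
    from zero[OF _ this] have "2 * Re (h1 z * w - (of_real (Im z) * (g2 z * w) + of_real (Im w) * g1 z))
        - Im (g1 z * w) = 0" for w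
      using eq by (simp add: h_def g1_def)
    from this[of 1] this[of \<i>] show ?thesis
      by (simp add: complex_eq_iff)
  qed
  have 2: "2 * (h2 z * w - (of_real (Im z) * (g3 z * w) + of_real (Im w) * g2 z))
      - of_real (Im (g2 z * w)) + 3 * \<i> * of_real (Re (g2 z * w)) = 0" for z w
  proof -
    have der: "((\<lambda>z. 2 * (h1 z - of_real (Im z) * g2 z) - of_real (Im (g1 z)) + 3 * \<i> * of_real (Re (g1 z)))
      has_derivative (\<lambda>w. 2 * (h2 z * w - (of_real (Im z) * (g3 z * w) + of_real (Im w) * g2 z))
      - of_real (Im (g2 z * w)) + 3 * \<i> * of_real (Re (g2 z * w)))) (at z)"
      by (intro derivative_intros D)
    have 0: "2 * (h1 z - of_real (Im z) * g2 z) - of_real (Im (g1 z)) + 3 * \<i> * of_real (Re (g1 z)) = 0" for z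
      by (subst 1) simp
    show ?thesis
      by (rule zero[OF 0 der])
  qed
  \<comment> \<open>Subtracting \<i> times the instance \<open>w = 1\<close> from the instance
    \<open>w = \<i>\<close> cancels \<open>h2\<close> and \<open>g3\<close> and leaves a nonzero
    multiple of \<open>Im (g2 z)\<close>.\<close>
  have g2: "Im (g2 z) = 0" for z
    using 2[of z 1] 2[of z \<i>] by (simp add: complex_eq_iff)
  have g3: "g3 z = 0" for z
    unfolding g3_def by (rule real_valued_deriv_zero[OF hol(2) open_UNIV]) (auto simp: g2)
  obtain c' where c': "\<And>z. g2 z = c'"
    using affine_of_deriv_const[OF convex_UNIV open_UNIV hol(2), of 0] g3 by (auto simp: g3_def)
  have Imc: "Im c' = 0"
    using g2[of 0] c' by simp
  have h2: "h2 z = - (3 * \<i> / 2) * c'" for z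
    using 2[of z 1] Imc by (simp add: c' g3 complex_eq_iff)
  obtain \<alpha> where \<alpha>: "\<And>z. g1 z = c' * z + \<alpha>"
    using affine_of_deriv_const[OF convex_UNIV open_UNIV hol(1), of c'] c' by (auto simp: g2_def)
  obtain \<beta> where \<beta>: "\<And>z. g z = c' / 2 * z\<^sup>2 + \<alpha> * z + \<beta>"
    using quadratic_of_deriv_affine[OF convex_UNIV open_UNIV g, of c' \<alpha>] \<alpha> by (auto simp: g1_def)
  obtain \<rho> where \<rho>: "\<And>z. h1 z = - (3 * \<i> / 2) * c' * z + \<rho>"
    using affine_of_deriv_const[OF convex_UNIV open_UNIV hol(4), of "- (3 * \<i> / 2) * c'"] h2
    by (auto simp: h2_def)
  \<comment> \<open>At \<open>z = 0\<close> the first differentiated equation ties the quadratic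
    coefficient of \<open>k\<close> to the linear coefficient of \<open>g\<close>.\<close>
  have \<rho>_eq: "2 * \<rho> = of_real (Im \<alpha>) - 3 * \<i> * of_real (Re \<alpha>)"
    using 1[of 0] by (simp add: \<alpha> \<rho>)
  obtain \<gamma> where \<gamma>: "\<And>z. h z = (- (3 * \<i> / 2) * c') / 2 * z\<^sup>2 + \<rho> * z + \<gamma>"
    using quadratic_of_deriv_affine[OF convex_UNIV open_UNIV hol(3), of "- (3 * \<i> / 2) * c'" \<rho>] \<rho>
    by (auto simp: h1_def)
  define b where "b = (- (3 * \<i> / 2) * c') / (2 * of_real v)"
  have "deriv k z = b * z\<^sup>2 + \<rho> / of_real v * z + \<gamma> / of_real v" for z
    using \<gamma>[of z] v by (simp add: h_def b_def field_simps)
  then obtain \<delta> where \<delta>: "\<And>z. k z = b / 3 * z ^ 3 + \<rho> / of_real v / 2 * z\<^sup>2 + \<gamma> / of_real v * z + \<delta>"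
    using cubic_of_deriv_quadratic[OF convex_UNIV open_UNIV k, of b "\<rho> / of_real v" "\<gamma> / of_real v"] by auto
  show thesis
  proof (rule that[of "c' / 2" \<alpha> \<beta> "\<gamma> / of_real v" \<delta>])
    show "k z = - (\<i> * (c' / 2) / (2 * of_real v)) * z ^ 3
      + (of_real (Im \<alpha>) - 3 * \<i> * of_real (Re \<alpha>)) / (4 * of_real v) * z\<^sup>2 + \<gamma> / of_real v * z + \<delta>" for z
      unfolding \<delta> \<rho>_eq[symmetric] b_def using v by (simp add: field_simps)
  qed (use Imc \<beta> in auto)
qed

section \<open>Equations for the coefficients on the upper half-plane\<close>

text \<open>The antiholomorphic derivative kills \<open>A\<close> and \<open>c\<close> and sends
  \<open>Im \<tau>\<close> to \<i>/2, so it turns the equation into \<open>A = 0\<close>.\<close>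

lemma half_plane_product_zero:
  fixes A c :: "complex \<Rightarrow> complex"
  defines "U \<equiv> {\<tau>. Im \<tau> > 0}"
  assumes A: "A holomorphic_on U" and c: "c holomorphic_on U"
    and eq: "\<And>\<tau>. \<tau> \<in> U \<Longrightarrow> of_real (Im \<tau>) * A \<tau> = c \<tau>" and \<tau>: "\<tau> \<in> U"
  shows "A \<tau> = 0"
proof -
  have U: "open U"
    by (simp add: U_def open_halfspace_Im_gt)
  note d = has_derivative_deriv[OF _ U \<tau>]
  have "((\<lambda>t. of_real (Im t) * A t - c t) has_derivative
     (\<lambda>w. (of_real (Im \<tau>) * (deriv A \<tau> * w) + of_real (Im w) * A \<tau>) - deriv c \<tau> * w)) (at \<tau>)"
    by (intro derivative_intros d A c)
  from has_derivative_of_zero[OF U \<tau> _ this]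
  have "(of_real (Im \<tau>) * (deriv A \<tau> * w) + of_real (Im w) * A \<tau>) - deriv c \<tau> * w = 0" for w
    by (simp add: eq)
  from this[of 1] this[of \<i>] show ?thesis
    by (simp add: algebra_simps)
qed

text \<open>The antiholomorphic derivative of the equation gives
  \<open>2 * B + cnj (deriv \<alpha>) = 0\<close>. Then \<open>B\<close> is both holomorphic and
  antiholomorphic, so its derivative vanishes; differentiating the equation along 1 now yields
  \<open>deriv \<alpha> = 0\<close>, and \<open>B\<close> and \<open>\<alpha>\<close>
  follow.\<close>

lemma half_plane_linear_term_zero:
  fixes \<alpha> B :: "complex \<Rightarrow> complex"
  defines "U \<equiv> {\<tau>. Im \<tau> > 0}"
  assumes \<alpha>: "\<alpha> holomorphic_on U" and B: "B holomorphic_on U"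
    and eq: "\<And>\<tau>. \<tau> \<in> U \<Longrightarrow>
      4 * (of_real (Im \<tau>) * B \<tau>) = of_real (Im (\<alpha> \<tau>)) - 3 * \<i> * of_real (Re (\<alpha> \<tau>))"
    and \<tau>: "\<tau> \<in> U"
  shows "\<alpha> \<tau> = 0" "B \<tau> = 0"
proof -
  have U: "open U"
    by (simp add: U_def open_halfspace_Im_gt)
  note d = has_derivative_deriv[OF _ U]
  have 1: "4 * (of_real (Im t) * (deriv B t * w) + of_real (Im w) * B t)
      - of_real (Im (deriv \<alpha> t * w)) + 3 * \<i> * of_real (Re (deriv \<alpha> t * w)) = 0" if "t \<in> U" for t w
  proof -
    have "((\<lambda>t. 4 * (of_real (Im t) * B t) - of_real (Im (\<alpha> t)) + 3 * \<i> * of_real (Re (\<alpha> t))) has_derivative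
      (\<lambda>w. 4 * (of_real (Im t) * (deriv B t * w) + of_real (Im w) * B t)
      - of_real (Im (deriv \<alpha> t * w)) + 3 * \<i> * of_real (Re (deriv \<alpha> t * w)))) (at t)"
      by (intro derivative_intros d \<alpha> B that)
    from has_derivative_of_zero[OF U that _ this] show ?thesis
      by (simp add: eq)
  qed
  have 2: "2 * B t + cnj (deriv \<alpha> t) = 0" if "t \<in> U" for t
    using 1[OF that, of 1] 1[OF that, of \<i>] by (simp add: complex_eq_iff algebra_simps)
  have 3: "deriv B t = 0" if "t \<in> U" for t
  proof -
    have "((\<lambda>t. 2 * B t + cnj (deriv \<alpha> t)) has_derivative
      (\<lambda>w. 2 * (deriv B t * w) + cnj (deriv (deriv \<alpha>) t * w))) (at t)"
      by (intro derivative_intros d \<alpha> B that holomorphic_deriv U)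
    from has_derivative_of_zero[OF U that _ this]
    have "2 * (deriv B t * w) + cnj (deriv (deriv \<alpha>) t * w) = 0" for w
      by (simp add: 2)
    from this[of 1] this[of \<i>] show ?thesis
      by (simp add: complex_eq_iff)
  qed
  have "deriv \<alpha> \<tau> = 0"
    using 1[OF \<tau>, of 1] 3[OF \<tau>] by (simp add: complex_eq_iff)
  then show "B \<tau> = 0"
    using 2[OF \<tau>] by simp
  then show "\<alpha> \<tau> = 0"
    using eq[OF \<tau>] by (simp add: complex_eq_iff)
qed

text \<open>The right-hand side is real, so \<open>deriv \<delta>\<close> is real valued and
  holomorphic, hence a real constant. The equation at \<i> makes the constant term real too.\<close>

lemma half_plane_affine:
  fixes \<delta> :: "complex \<Rightarrow> complex"
  defines "U \<equiv> {\<tau>. Im \<tau> > 0}"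
  assumes \<delta>: "\<delta> holomorphic_on U"
    and eq: "\<And>\<tau>. \<tau> \<in> U \<Longrightarrow> of_real (Im \<tau>) * cnj (deriv \<delta> \<tau>) = of_real (Im (\<delta> \<tau>))"
  obtains l m :: real where "\<And>\<tau>. \<tau> \<in> U \<Longrightarrow> \<delta> \<tau> = of_real l * \<tau> + of_real m"
proof -
  have U: "open U" "convex U"
    by (simp_all add: U_def open_halfspace_Im_gt convex_halfspace_Im_gt)
  have "\<i> \<in> U"
    by (simp add: U_def)
  have hol: "deriv \<delta> holomorphic_on U"
    by (intro holomorphic_deriv \<delta> U)
  have im: "Im (deriv \<delta> \<tau>) = 0" if "\<tau> \<in> U" for \<tau>
    using eq[OF that] that by (auto simp: U_def complex_eq_iff)
  obtain l where l: "\<And>\<tau>. \<tau> \<in> U \<Longrightarrow> deriv \<delta> \<tau> = l"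
    using affine_of_deriv_const[OF U(2,1) hol, of 0] real_valued_deriv_zero[OF hol U(1) im] by auto
  obtain m where m: "\<And>\<tau>. \<tau> \<in> U \<Longrightarrow> \<delta> \<tau> = l * \<tau> + m"
    using affine_of_deriv_const[OF U(2,1) \<delta> l] by auto
  have "Im l = 0" "Im m = 0"
    using im[OF \<open>\<i> \<in> U\<close>] l[OF \<open>\<i> \<in> U\<close>] eq[OF \<open>\<i> \<in> U\<close>] m[OF \<open>\<i> \<in> U\<close>] by (auto simp: complex_eq_iff)
  then show thesis
    using m by (intro that[of "Re l" "Re m"]) (simp add: complex_eq_iff)
qed

lemma half_plane_quadratic:
  fixes \<beta> :: "complex \<Rightarrow> complex" and a c :: real
  defines "U \<equiv> {\<tau>. Im \<tau> > 0}"
  assumes \<beta>: "\<beta> holomorphic_on U"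
    and eq1: "\<And>\<tau>. \<tau> \<in> U \<Longrightarrow> Im (\<beta> \<tau>) = 2 * Im \<tau> * (a * Re \<tau> + c)"
    and eq2: "\<And>\<tau>. \<tau> \<in> U \<Longrightarrow> Im \<tau> * Re (deriv \<beta> \<tau>) = Im (\<beta> \<tau>)"
  obtains d :: real where "\<And>\<tau>. \<tau> \<in> U \<Longrightarrow> \<beta> \<tau> = of_real a * \<tau>\<^sup>2 + 2 * of_real c * \<tau> + of_real d"
proof -
  have U: "open U" "convex U"
    by (simp_all add: U_def open_halfspace_Im_gt convex_halfspace_Im_gt)
  \<comment> \<open>The two equations fix the real part of \<open>deriv \<beta>\<close>. The factor
    \<i> turns the purely imaginary remainder into a real-valued function, so that
    \<open>real_valued_deriv_zero\<close> applies.\<close>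
  define F where "F = (\<lambda>\<tau>. \<i> * (deriv \<beta> \<tau> - 2 * of_real a * \<tau>))"
  have hol: "deriv \<beta> holomorphic_on U" "F holomorphic_on U"
    by (auto simp: F_def intro!: holomorphic_intros holomorphic_deriv \<beta> U)
  have re: "Re (deriv \<beta> \<tau>) = 2 * a * Re \<tau> + 2 * c" if "\<tau> \<in> U" for \<tau>
  proof -
    have "Im \<tau> * Re (deriv \<beta> \<tau>) = Im \<tau> * (2 * a * Re \<tau> + 2 * c)"
      using eq1[OF that] eq2[OF that] by (simp add: algebra_simps)
    then show ?thesis
      using that unfolding U_def mult_cancel_left by auto
  qed
  have dF: "deriv (\<lambda>\<tau>. F \<tau> - \<i> * (2 * c)) \<tau> = 0" if "\<tau> \<in> U" for \<tau>
    by (rule real_valued_deriv_zero[OF _ U(1)])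
      (use that re in \<open>auto simp: F_def intro!: holomorphic_intros holomorphic_deriv \<beta> U\<close>)
  obtain e0 where e0: "\<And>\<tau>. \<tau> \<in> U \<Longrightarrow> F \<tau> - \<i> * (2 * c) = 0 * \<tau> + e0"
    by (rule affine_of_deriv_const[OF U(2,1) _ dF]) (auto intro!: holomorphic_intros hol)
  define e where "e = 2 * c - \<i> * e0"
  have "deriv \<beta> \<tau> = 2 * of_real a * \<tau> + e" if "\<tau> \<in> U" for \<tau>
    using e0[OF that] by (auto simp: F_def e_def complex_eq_iff)
  then obtain d where d: "\<And>\<tau>. \<tau> \<in> U \<Longrightarrow> \<beta> \<tau> = 2 * of_real a / 2 * \<tau>\<^sup>2 + e * \<tau> + d"
    using quadratic_of_deriv_affine[OF U(2,1) \<beta>, of "2 * of_real a" e] by metis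
  have "Im (e * \<tau>) + Im d = 2 * Im \<tau> * c" if "\<tau> \<in> U" for \<tau>
    using eq1[OF that] d[OF that] by (simp add: algebra_simps power2_eq_square)
  \<comment> \<open>The points \<i> and \<open>2 * \<i>\<close> separate \<open>Re e\<close> from
    \<open>Im d\<close>, and \<open>1 + \<i>\<close> detects \<open>Im e\<close>.\<close>
  from this[of \<i>] this[of "2 * \<i>"] this[of "1 + \<i>"] have "Im d = 0" "Re e = 2 * c" "Im e = 0"
    by (simp_all add: U_def)
  then show thesis
    using d by (intro that[of "Re d"]) (auto simp: complex_eq_iff)
qed

lemma kaehler_field_form:
  assumes f: "f \<in> kaehler_functions SJ KB_metric SJ_J"
  obtains a c d l m :: real where "\<And>\<tau> z. Im \<tau> > 0 \<Longrightarrow> hamiltonian_field KB_form f (\<tau>, z) =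
    (of_real a * \<tau>\<^sup>2 + 2 * of_real c * \<tau> + of_real d,
     (of_real a * \<tau> + of_real c) * z + of_real l * \<tau> + of_real m)"
proof -
  define X1 X2 where "X1 = (\<lambda>\<tau> z. fst (hamiltonian_field KB_form f (\<tau>, z)))"
    and "X2 = (\<lambda>\<tau> z. snd (hamiltonian_field KB_form f (\<tau>, z)))"
  define U where "U = {\<tau>. Im \<tau> > 0}"
  have U: "open U" "convex U"
    by (simp_all add: U_def open_halfspace_Im_gt convex_halfspace_Im_gt)
  have ex: "\<exists>P Q R S. ((\<lambda>t. X1 t z) has_field_derivative P) (at \<tau>) \<and>
      (X1 \<tau> has_field_derivative Q) (at z) \<and> ((\<lambda>t. X2 t z) has_field_derivative R) (at \<tau>) \<and>
      (X2 \<tau> has_field_derivative S) (at z) \<and>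
      2 * Re (of_real (Im \<tau>) * S - of_real (Im z) * Q) = Im (X1 \<tau> z) \<and>
      2 * Re (of_real (Im \<tau> * (Im \<tau> + (Im z)\<^sup>2)) * P - of_real (Im z * (Im \<tau>)\<^sup>2) * R)
        = (2 * Im \<tau> + 3 * (Im z)\<^sup>2) * Im (X1 \<tau> z) - 2 * Im z * Im \<tau> * Im (X2 \<tau> z) \<and>
      of_real (2 * Im z * Im (X1 \<tau> z) - Im \<tau> * Im (X2 \<tau> z))
        - of_real (Im \<tau> * Im z) * cnj P + of_real ((Im \<tau>)\<^sup>2) * cnj R
        + of_real (Im \<tau> + (Im z)\<^sup>2) * Q - of_real (Im \<tau> * Im z) * S = 0"
    if "\<tau> \<in> U" for \<tau> z
    using that unfolding U_def mem_Collect_eq X1_def X2_def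
    by (rule kaehler_field_equations[OF f, of \<tau> z]) blast
  have hol: "X1 \<tau> holomorphic_on UNIV" "X2 \<tau> holomorphic_on UNIV" if "\<tau> \<in> U" for \<tau>
    using ex[OF that] unfolding holomorphic_on_open[OF open_UNIV] by blast+
  have hol': "(\<lambda>t. X1 t z) holomorphic_on U" "(\<lambda>t. X2 t z) holomorphic_on U" for z
    using ex unfolding holomorphic_on_open[OF U(1)] by blast+
  have E: "2 * Re (of_real (Im \<tau>) * deriv (X2 \<tau>) z - of_real (Im z) * deriv (X1 \<tau>) z) = Im (X1 \<tau> z)"
    "2 * Re (of_real (Im \<tau> * (Im \<tau> + (Im z)\<^sup>2)) * deriv (\<lambda>t. X1 t z) \<tau>
        - of_real (Im z * (Im \<tau>)\<^sup>2) * deriv (\<lambda>t. X2 t z) \<tau>)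
      = (2 * Im \<tau> + 3 * (Im z)\<^sup>2) * Im (X1 \<tau> z) - 2 * Im z * Im \<tau> * Im (X2 \<tau> z)"
    "of_real (2 * Im z * Im (X1 \<tau> z) - Im \<tau> * Im (X2 \<tau> z))
      - of_real (Im \<tau> * Im z) * cnj (deriv (\<lambda>t. X1 t z) \<tau>) + of_real ((Im \<tau>)\<^sup>2) * cnj (deriv (\<lambda>t. X2 t z) \<tau>)
      + of_real (Im \<tau> + (Im z)\<^sup>2) * deriv (X1 \<tau>) z - of_real (Im \<tau> * Im z) * deriv (X2 \<tau>) z = 0"
    if "\<tau> \<in> U" for \<tau> z
    using ex[OF that, of z] by (auto dest!: DERIV_imp_deriv)
  have "\<exists>c \<alpha> \<beta> \<gamma> \<delta>. (\<forall>z. X1 \<tau> z = c * z\<^sup>2 + \<alpha> * z + \<beta>) \<and>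
      (\<forall>z. X2 \<tau> z = - (\<i> * c / (2 * of_real (Im \<tau>))) * z ^ 3
      + (of_real (Im \<alpha>) - 3 * \<i> * of_real (Re \<alpha>)) / (4 * of_real (Im \<tau>)) * z\<^sup>2 + \<gamma> * z + \<delta>)"
    if "\<tau> \<in> U" for \<tau>
  proof -
    have v: "Im \<tau> \<noteq> 0"
      using that by (simp add: U_def)
    show ?thesis
      by (rule fiber_equation_solution[OF hol[OF that] v E(1)[OF that]]) blast
  qed
  then obtain c \<alpha> \<beta> \<gamma> \<delta> where
    X1: "\<And>\<tau> z. \<tau> \<in> U \<Longrightarrow> X1 \<tau> z = c \<tau> * z\<^sup>2 + \<alpha> \<tau> * z + \<beta> \<tau>"
    and X2: "\<And>\<tau> z. \<tau> \<in> U \<Longrightarrow> X2 \<tau> z = - (\<i> * c \<tau> / (2 * of_real (Im \<tau>))) * z ^ 3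
      + (of_real (Im (\<alpha> \<tau>)) - 3 * \<i> * of_real (Re (\<alpha> \<tau>))) / (4 * of_real (Im \<tau>)) * z\<^sup>2 + \<gamma> \<tau> * z + \<delta> \<tau>"
    by metis
  \<comment> \<open>The coefficients of the polynomials in \<open>z\<close> are holomorphic in \<open>\<tau>\<close>, since finite differences of
    \<open>X1\<close> and \<open>X2\<close> in \<open>z\<close> express them.\<close>
  note hol_combine = holomorphic_intros hol'
  have c0: "c \<tau> = 0" if \<tau>: "\<tau> \<in> U" for \<tau>
  proof -
    \<comment> \<open>This odd third difference cancels the constant, linear and quadratic terms and
      takes the value 12 on the cube, so \<open>A\<close> is the cubic coefficient of
      \<open>X2\<close>.\<close>
    define A where "A = (\<lambda>t. (X2 t 2 - 2 * X2 t 1 + 2 * X2 t (- 1) - X2 t (- 2)) / 12)"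
    define B where "B = (\<lambda>t. - \<i> / 4 * (X1 t 1 + X1 t (- 1) - 2 * X1 t 0))"
    have A: "A t = - (\<i> * c t / (2 * of_real (Im t)))" and B: "B t = - \<i> / 2 * c t" if "t \<in> U" for t
      using that by (simp_all add: A_def B_def X1 X2 field_simps)
    have "A \<tau> = 0"
    proof (rule half_plane_product_zero[of A B])
      show "A holomorphic_on {\<tau>. Im \<tau> > 0}" "B holomorphic_on {\<tau>. Im \<tau> > 0}"
        unfolding A_def B_def U_def[symmetric] by (intro hol_combine; simp)+
    qed (use A B \<tau> in \<open>auto simp: U_def\<close>)
    then show ?thesis
      using A[OF \<tau>] \<tau> by (auto simp: U_def)
  qed
  have \<alpha>0: "\<alpha> \<tau> = 0" if \<tau>: "\<tau> \<in> U" for \<tau>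
  proof -
    define A where "A = (\<lambda>t. (X1 t 1 - X1 t (- 1)) / 2)"
    define B where "B = (\<lambda>t. (X2 t 1 + X2 t (- 1) - 2 * X2 t 0) / 2)"
    have A: "A t = \<alpha> t"
      and B: "B t = (of_real (Im (\<alpha> t)) - 3 * \<i> * of_real (Re (\<alpha> t))) / (4 * of_real (Im t))" if "t \<in> U" for t
      using that by (simp_all add: A_def B_def X1 X2)
    have "A \<tau> = 0"
    proof (rule half_plane_linear_term_zero[of A B])
      show "A holomorphic_on {\<tau>. Im \<tau> > 0}" "B holomorphic_on {\<tau>. Im \<tau> > 0}"
        unfolding A_def B_def U_def[symmetric] by (intro hol_combine; simp)+
    qed (use A B \<tau> in \<open>auto simp: U_def\<close>)
    then show ?thesis
      using A[OF \<tau>] by simp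
  qed
  \<comment> \<open>The coefficients that remain are values of \<open>X1\<close> and
    \<open>X2\<close> at \<open>z = 0\<close> and \<open>z = 1\<close>; defined in this way they
    inherit holomorphy in \<open>\<tau>\<close>.\<close>
  define \<beta>' \<gamma>' \<delta>' where "\<beta>' = (\<lambda>\<tau>. X1 \<tau> 0)" and "\<gamma>' = (\<lambda>\<tau>. X2 \<tau> 1 - X2 \<tau> 0)"
    and "\<delta>' = (\<lambda>\<tau>. X2 \<tau> 0)"
  have X': "X1 \<tau> = (\<lambda>_. \<beta>' \<tau>)" "X2 \<tau> = (\<lambda>z. \<gamma>' \<tau> * z + \<delta>' \<tau>)" if "\<tau> \<in> U" for \<tau>
    using that by (simp_all add: fun_eq_iff \<beta>'_def \<gamma>'_def \<delta>'_def X1 X2 c0 \<alpha>0)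
  have dz: "deriv (X1 \<tau>) z = 0" "deriv (X2 \<tau>) z = \<gamma>' \<tau>" if "\<tau> \<in> U" for \<tau> z
    unfolding X'[OF that] by (auto intro!: DERIV_imp_deriv derivative_eq_intros)
  have hol'': "\<beta>' holomorphic_on U" "\<gamma>' holomorphic_on U" "\<delta>' holomorphic_on U"
    unfolding \<beta>'_def \<gamma>'_def \<delta>'_def by (intro hol_combine; simp)+
  have d\<gamma>: "deriv \<gamma>' \<tau> = deriv (\<lambda>t. X2 t 1) \<tau> - deriv \<delta>' \<tau>" if "\<tau> \<in> U" for \<tau>
    unfolding \<gamma>'_def \<delta>'_def
    by (intro deriv_diff holomorphic_on_imp_differentiable_at[OF _ U(1) that] hol')
  \<comment> \<open>The \<open>(\<tau>, z)\<close> equation is used at the real points 0 and 1: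
    terms with the factor \<open>Im z\<close> vanish, as does the derivative of \<open>X1\<close> in
    \<open>z\<close>. The difference of the two results is the same equation for
    \<open>\<gamma>'\<close>.\<close>
  have \<delta>_eq: "of_real (Im \<tau>) * cnj (deriv \<delta>' \<tau>) = of_real (Im (\<delta>' \<tau>))"
    and X21_eq: "of_real (Im \<tau>) * cnj (deriv (\<lambda>t. X2 t 1) \<tau>) = of_real (Im (\<gamma>' \<tau> + \<delta>' \<tau>))"
    if \<tau>: "\<tau> \<in> U" for \<tau>
  proof -
    have v: "complex_of_real (Im \<tau>) \<noteq> 0"
      using \<tau> by (simp add: U_def)
    have "of_real (Im \<tau>) * (of_real (Im \<tau>) * cnj (deriv \<delta>' \<tau>)) = of_real (Im \<tau>) * complex_of_real (Im (\<delta>' \<tau>))"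
      using E(3)[OF \<tau>, of 0] by (simp add: dz \<tau> \<delta>'_def power2_eq_square mult.assoc)
    then show "of_real (Im \<tau>) * cnj (deriv \<delta>' \<tau>) = of_real (Im (\<delta>' \<tau>))"
      using v by simp
    have "of_real (Im \<tau>) * (of_real (Im \<tau>) * cnj (deriv (\<lambda>t. X2 t 1) \<tau>))
        = of_real (Im \<tau>) * complex_of_real (Im (\<gamma>' \<tau> + \<delta>' \<tau>))"
      using E(3)[OF \<tau>, of 1] by (simp add: dz \<tau> \<gamma>'_def \<delta>'_def power2_eq_square mult.assoc)
    then show "of_real (Im \<tau>) * cnj (deriv (\<lambda>t. X2 t 1) \<tau>) = of_real (Im (\<gamma>' \<tau> + \<delta>' \<tau>))"
      using v by simp
  qed
  obtain l m :: real where lm: "\<And>\<tau>. \<tau> \<in> U \<Longrightarrow> \<delta>' \<tau> = of_real l * \<tau> + of_real m"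
    using half_plane_affine[OF hol''(3)[unfolded U_def]] \<delta>_eq unfolding U_def by blast
  have \<gamma>_eq: "of_real (Im \<tau>) * cnj (deriv \<gamma>' \<tau>) = of_real (Im (\<gamma>' \<tau>))" if "\<tau> \<in> U" for \<tau>
    using \<delta>_eq[OF that] X21_eq[OF that] by (simp add: d\<gamma> that right_diff_distrib)
  obtain a e :: real where ae: "\<And>\<tau>. \<tau> \<in> U \<Longrightarrow> \<gamma>' \<tau> = of_real a * \<tau> + of_real e"
    using half_plane_affine[OF hol''(2)[unfolded U_def]] \<gamma>_eq unfolding U_def by blast
  \<comment> \<open>At \<open>z = 0\<close> the \<open>(z, z)\<close> and
    \<open>(\<tau>, \<tau>)\<close> equations become the two hypotheses of
    \<open>half_plane_quadratic\<close>.\<close>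
  have \<beta>1: "Im (\<beta>' \<tau>) = 2 * Im \<tau> * (a * Re \<tau> + e)" if "\<tau> \<in> U" for \<tau>
    using E(1)[OF that, of 0] by (simp add: dz that ae \<beta>'_def)
  have \<beta>2: "Im \<tau> * Re (deriv \<beta>' \<tau>) = Im (\<beta>' \<tau>)" if "\<tau> \<in> U" for \<tau>
  proof -
    have "Im \<tau> * (Im \<tau> * Re (deriv \<beta>' \<tau>)) = Im \<tau> * Im (\<beta>' \<tau>)"
      using E(2)[OF that, of 0] by (simp add: \<beta>'_def)
    then show ?thesis
      using that by (simp add: U_def)
  qed
  obtain d :: real where d: "\<And>\<tau>. \<tau> \<in> U \<Longrightarrow> \<beta>' \<tau> = of_real a * \<tau>\<^sup>2 + 2 * of_real e * \<tau> + of_real d"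
    using half_plane_quadratic[OF hol''(1)[unfolded U_def]] \<beta>1 \<beta>2 unfolding U_def by blast
  show thesis
  proof (rule that[of a e d l m])
    fix \<tau> z :: complex
    assume "Im \<tau> > 0"
    then have \<tau>: "\<tau> \<in> U"
      by (simp add: U_def)
    have "hamiltonian_field KB_form f (\<tau>, z) = (X1 \<tau> z, X2 \<tau> z)"
      by (simp add: X1_def X2_def)
    then show "hamiltonian_field KB_form f (\<tau>, z) =
      (of_real a * \<tau>\<^sup>2 + 2 * of_real e * \<tau> + of_real d,
       (of_real a * \<tau> + of_real e) * z + of_real l * \<tau> + of_real m)"
      by (simp add: X' \<tau> d ae lm add.assoc)
  qed
qed

section \<open>The functions \<open>\<psi>(L)\<close>\<close>

text \<open>The expression uses only constants, coordinates, sums, products and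
  \<open>inverse v\<close>, the shape to which the C^k closure rules and the derivative computations
  below apply directly.\<close>

lemma psi_eq:
  assumes "p \<in> SJ"
  defines "u \<equiv> Re (fst p)" and "v \<equiv> Im (fst p)" and "x \<equiv> Re (snd p)" and "y \<equiv> Im (snd p)"
  defines "i \<equiv> inverse v"
  shows "psi (A, \<xi>, r) p =
      A $ 1 $ 2 * ((- 1 / 4) * (y * y * i * i) + (- 1 / 2) * i)
    + A $ 2 $ 1 * ((1 / 4) * (x * x) + (1 / 4) * (y * y * i * i * u * u) + (1 / 2) * (i * u * u)
        + (- 1 / 2) * (y * x * u * i) + (1 / 2) * v)
    + A $ 1 $ 1 * ((1 / 2) * (x * y * i) + (- 1 / 2) * (u * y * y * i * i) + (- 1) * (u * i))
    + \<xi> $ 1 * ((- 1 / 2) * x + (1 / 2) * (u * y * i)) + \<xi> $ 2 * ((1 / 2) * (y * i)) + r * (- 1 / 4)"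
proof -
  have v: "v \<noteq> 0"
    using assms by (simp add: v_def SJ_iff)
  have e1: "eta1 p = (1 / 2) * (y * i)" and e2: "eta2 p = (1 / 4) * (y * y * i * i) + (1 / 2) * i"
    using v by (simp_all add: eta1_def eta2_def theta1_def theta2_def y_def[symmetric] v_def[symmetric] i_def
        field_simps power2_eq_square)
  \<comment> \<open>The \<theta>1 terms cancel: \<open>eta1\<close> squared minus
    \<open>eta2\<close> is -1/(2v).\<close>
  have e3: "1 / (4 * ((eta1 p)\<^sup>2 - eta2 p)) = - v / 2"
    using v by (simp add: e1 e2 i_def field_simps power2_eq_square)
  show ?thesis
    using assms(1)
    by (simp add: psi_def zero_extension_def e3)
      (simp add: e1 e2 thetadot1_def thetadot2_def x_def u_def algebra_simps power2_eq_square,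
        simp add: i_def divide_inverse)
qed

lemma Ck_on_psi: "Ck_on k SJ (psi L)"
proof (cases L)
  case (fields A \<xi> r)
  let ?u = "\<lambda>p::complex \<times> complex. Re (fst p)" and ?v = "\<lambda>p::complex \<times> complex. Im (fst p)"
    and ?x = "\<lambda>p::complex \<times> complex. Re (snd p)" and ?y = "\<lambda>p::complex \<times> complex. Im (snd p)"
  have lin: "Ck_on k SJ ?u" "Ck_on k SJ ?v" "Ck_on k SJ ?x" "Ck_on k SJ ?y"
    by (intro Ck_on_bounded_linear[OF open_SJ] bounded_linear_compose[OF bounded_linear_Re]
        bounded_linear_compose[OF bounded_linear_Im] bounded_linear_fst bounded_linear_snd)+
  have inv: "Ck_on k SJ (\<lambda>p. inverse (?v p))"
    by (rule Ck_on_inverse[OF open_SJ lin(2)]) (simp add: SJ_iff)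
  show ?thesis
    unfolding fields
    by (rule Ck_on_cong[OF open_SJ psi_eq[symmetric]])
      (assumption, intro Ck_on_add[OF open_SJ] Ck_on_mult[OF open_SJ] Ck_on_const lin inv)
qed

text \<open>The Hamiltonian field of \<open>psi L\<close>, in the shape found in
  \<open>kaehler_field_form\<close> with a = -A21, c = A11, d = A12 and (l, m) = \<xi>. The
  coordinate \<open>r\<close> shifts \<open>psi L\<close> by a constant, whose field is
  zero.\<close>

definition jacobi_field :: "jacobi_vec \<Rightarrow> complex \<times> complex \<Rightarrow> complex \<times> complex"
  where "jacobi_field = (\<lambda>(A, \<xi>, r) (\<tau>, z).
    (of_real (- A $ 2 $ 1) * \<tau>\<^sup>2 + of_real (2 * A $ 1 $ 1) * \<tau> + of_real (A $ 1 $ 2),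
     (of_real (- A $ 2 $ 1) * \<tau> + of_real (A $ 1 $ 1)) * z + of_real (\<xi> $ 1) * \<tau> + of_real (\<xi> $ 2)))"

text \<open>Both sides are linear in the coordinates of \<open>L\<close>, so it suffices to
  differentiate the images of \<open>F\<close>, \<open>G\<close>, \<open>H\<close>,
  \<open>P\<close>, \<open>Q\<close>, whose fields are (1, 0), (-\<tau>\<tau>, -\<tau>z), (2\<tau>,
  z), (0, \<tau>) and (0, 1).\<close>

lemma has_derivative_psi:
  assumes p: "p \<in> SJ"
  shows "(psi L has_derivative KB_form p (jacobi_field L p)) (at p)"
proof (cases L)
  case (fields A \<xi> r)
  have v: "Im (fst p) > 0"
    using p by (simp add: SJ_iff)
  have inv: "((\<lambda>q::complex \<times> complex. inverse (Im (fst q))) has_derivative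
      (\<lambda>h. - (Im (fst h) * inverse (Im (fst p)) * inverse (Im (fst p))))) (at p)"
    using v by (auto intro!: derivative_eq_intros simp: fun_eq_iff)
  note expand = kaehler_form_def KB_metric_eq inner_complex_def fun_eq_iff
  note powers = power2_eq_square power3_eq_cube
  have F: "((\<lambda>p::complex \<times> complex. - 1 / 4 * (Im (snd p) * Im (snd p) * inverse (Im (fst p)) * inverse (Im (fst p)))
      + - 1 / 2 * inverse (Im (fst p))) has_derivative KB_form p (1, 0)) (at p)"
    by (rule derivative_eq_intros inv refl)+ (use v in \<open>simp add: expand field_simps powers\<close>)
  have Q: "((\<lambda>p::complex \<times> complex. 1 / 2 * (Im (snd p) * inverse (Im (fst p)))) has_derivative KB_form p (0, 1)) (at p)"
    by (rule derivative_eq_intros inv refl)+ (use v in \<open>simp add: expand field_simps powers\<close>)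
  have P: "((\<lambda>p::complex \<times> complex. - 1 / 2 * Re (snd p) + 1 / 2 * (Re (fst p) * Im (snd p) * inverse (Im (fst p))))
      has_derivative KB_form p (0, fst p)) (at p)"
    by (rule derivative_eq_intros inv refl)+ (use v in \<open>simp add: expand field_simps powers\<close>)
  have H: "((\<lambda>p::complex \<times> complex. 1 / 2 * (Re (snd p) * Im (snd p) * inverse (Im (fst p)))
      + - 1 / 2 * (Re (fst p) * Im (snd p) * Im (snd p) * inverse (Im (fst p)) * inverse (Im (fst p)))
      + - 1 * (Re (fst p) * inverse (Im (fst p)))) has_derivative KB_form p (2 * fst p, snd p)) (at p)"
    by (rule derivative_eq_intros inv refl)+ (use v in \<open>simp add: expand field_simps powers\<close>)
  have G: "((\<lambda>p::complex \<times> complex. 1 / 4 * (Re (snd p) * Re (snd p))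
      + 1 / 4 * (Im (snd p) * Im (snd p) * inverse (Im (fst p)) * inverse (Im (fst p)) * Re (fst p) * Re (fst p))
      + 1 / 2 * (inverse (Im (fst p)) * Re (fst p) * Re (fst p))
      + - 1 / 2 * (Im (snd p) * Re (snd p) * Re (fst p) * inverse (Im (fst p)))
      + 1 / 2 * Im (fst p)) has_derivative KB_form p (- (fst p * fst p), - (fst p * snd p))) (at p)"
    by (rule derivative_eq_intros inv refl)+ (use v in \<open>simp add: expand field_simps powers\<close>)
  have lin: "KB_form p (jacobi_field L p) = (\<lambda>h. A $ 1 $ 2 * KB_form p (1, 0) h
      + A $ 2 $ 1 * KB_form p (- (fst p * fst p), - (fst p * snd p)) h
      + A $ 1 $ 1 * KB_form p (2 * fst p, snd p) h
      + \<xi> $ 1 * KB_form p (0, fst p) h + \<xi> $ 2 * KB_form p (0, 1) h + 0)"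
    by (simp add: jacobi_field_def fields split_beta expand power2_eq_square algebra_simps
        add_divide_distrib diff_divide_distrib)
  show ?thesis
    unfolding lin
    by (rule has_derivative_transform_within_open[OF _ open_SJ p psi_eq[symmetric, of _ A \<xi> r, folded fields]])
      (intro has_derivative_add has_derivative_mult_right has_derivative_const F G H P Q)
qed

lemma psi_outside: "p \<notin> SJ \<Longrightarrow> psi L p = 0"
  by (cases L) (simp add: psi_def zero_extension_def)

lemma hamiltonian_field_psi: "p \<in> SJ \<Longrightarrow> hamiltonian_field KB_form (psi L) p = jacobi_field L p"
  using fun_cong[OF frechet_derivative_at[OF has_derivative_psi]] by (intro hamiltonian_field_KB_eqI)

lemma psi_in_kaehler_functions: "psi L \<in> kaehler_functions SJ KB_metric SJ_J"
proof -
  obtain A \<xi> r where L: "L = (A, \<xi>, r)"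
    by (cases L)
  have "lie_derivative_metric (hamiltonian_field KB_form (psi L)) KB_metric p V W = 0"
    if p: "p \<in> SJ" for p V W
  proof -
    obtain \<tau> z where \<tau>z: "p = (\<tau>, z)"
      by (cases p)
    have v: "Im \<tau> > 0"
      using p by (simp add: \<tau>z SJ_iff)
    define D where "D = (\<lambda>h::complex \<times> complex.
      (- of_real (A $ 2 $ 1) * (2 * \<tau> * fst h) + of_real (2 * A $ 1 $ 1) * fst h,
       - of_real (A $ 2 $ 1) * (fst h * z + \<tau> * snd h) + of_real (A $ 1 $ 1) * snd h + of_real (\<xi> $ 1) * fst h))"
    have "(jacobi_field L has_derivative D) (at p)"
      unfolding jacobi_field_def L split_beta prod.sel D_def \<tau>z
      by (rule derivative_eq_intros refl)+ (simp add: fun_eq_iff algebra_simps)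
    then have "(hamiltonian_field KB_form (psi L) has_derivative D) (at p)"
      by (rule has_derivative_transform_within_open[OF _ open_SJ p]) (simp add: hamiltonian_field_psi)
    from frechet_derivative_at[OF this] have fd:
      "frechet_derivative (hamiltonian_field KB_form (psi L)) (at p) = D"
      by simp
    show ?thesis
      unfolding lie_derivative_metric_def fd frechet_derivative_KB_metric[OF p] hamiltonian_field_psi[OF p]
      using v
      by (simp add: \<tau>z L jacobi_field_def D_def KB_metric_deriv_def KB_metric_eq Let_def inner_complex_def
          field_simps power2_eq_square power3_eq_cube power4_eq_xxxx)
  qed
  then show ?thesis
    by (simp add: kaehler_functions_def psi_outside smooth_fun_on_def Ck_on_psi)
qed

lemma poisson_bracket_psi:
  assumes "L \<in> gJ" "M \<in> gJ"
  shows "poisson_bracket SJ KB_form (psi L) (psi M) = psi (gJ_bracket L M)"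
proof
  fix p
  obtain A \<xi> r where L: "L = (A, \<xi>, r)"
    by (cases L)
  obtain B \<eta> s where M: "M = (B, \<eta>, s)"
    by (cases M)
  \<comment> \<open>Trace zero eliminates the lower right entries, which occur in the matrix bracket
    but not in the formula for \<open>jacobi_field\<close>.\<close>
  have tr: "A $ 2 $ 2 = - A $ 1 $ 1" "B $ 2 $ 2 = - B $ 1 $ 1"
    using assms by (auto simp: gJ_def L M trace_def sum_2)
  show "poisson_bracket SJ KB_form (psi L) (psi M) p = psi (gJ_bracket L M) p"
  proof (cases "p \<in> SJ")
    case True
    then have v: "Im (fst p) > 0"
      by (simp add: SJ_iff)
    have "poisson_bracket SJ KB_form (psi L) (psi M) p = KB_form p (jacobi_field L p) (jacobi_field M p)"
      using True by (simp add: poisson_bracket_def zero_extension_def hamiltonian_field_psi)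
    also have "\<dots> = psi (gJ_bracket L M) p"
      using v unfolding L M gJ_bracket_def prod.case psi_eq[OF True]
      by (simp add: kaehler_form_def KB_metric_eq inner_complex_def jacobi_field_def split_beta
          matrix_matrix_mult_def vector_matrix_mult_def sum_2 Omega_def tr
          field_simps power2_eq_square power3_eq_cube)
    finally show ?thesis .
  qed (simp add: psi_outside poisson_bracket_def zero_extension_def)
qed

lemma psi_add: "psi (L + M) = psi L + psi M"
  by (cases L; cases M) (auto simp: psi_def zero_extension_def fun_eq_iff algebra_simps add_divide_distrib)

lemma psi_scaleR: "psi (c *\<^sub>R L) = fun_scale c (psi L)"
  by (cases L) (auto simp: psi_def zero_extension_def fun_scale_def fun_eq_iff algebra_simps)

text \<open>Equal functions have equal Hamiltonian fields. Their values at (\<i>, 0) and (2\<i>, 0)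
  recover everything except \<open>r\<close> and the entry fixed by the trace; a value of the
  function then gives \<open>r\<close>.\<close>

lemma inj_on_psi: "inj_on psi gJ"
proof (rule inj_onI)
  fix L M
  assume LM: "L \<in> gJ" "M \<in> gJ" and eq: "psi L = psi M"
  obtain A \<xi> r where L: "L = (A, \<xi>, r)"
    by (cases L)
  obtain B \<eta> s where M: "M = (B, \<eta>, s)"
    by (cases M)
  have "jacobi_field L p = jacobi_field M p" if "p \<in> SJ" for p
    using hamiltonian_field_psi[OF that, of L] hamiltonian_field_psi[OF that, of M] eq by simp
  from this[of "(\<i>, 0)"] this[of "(2 * \<i>, 0)"]
  have *: "A $ 2 $ 1 = B $ 2 $ 1" "A $ 1 $ 1 = B $ 1 $ 1" "A $ 1 $ 2 = B $ 1 $ 2" "\<xi> $ 1 = \<eta> $ 1" "\<xi> $ 2 = \<eta> $ 2"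
    by (simp_all add: SJ_iff jacobi_field_def L M complex_eq_iff)
  moreover have "A $ 2 $ 2 = B $ 2 $ 2"
    using LM * by (auto simp: gJ_def L M trace_def sum_2)
  moreover have "r = s"
    using fun_cong[OF eq, of "(\<i>, 0)"] * by (simp add: L M psi_eq SJ_iff)
  ultimately show "L = M"
    by (simp add: L M vec_eq_iff forall_2)
qed

lemma psi_surj: "psi ` gJ = kaehler_functions SJ KB_metric SJ_J"
proof (intro equalityI subsetI)
  fix f
  assume f: "f \<in> kaehler_functions SJ KB_metric SJ_J"
  then have out: "\<And>p. p \<notin> SJ \<Longrightarrow> f p = 0" and "Ck_on 1 SJ f"
    by (auto simp: kaehler_functions_def smooth_fun_on_def)
  then have df: "\<And>p. p \<in> SJ \<Longrightarrow> f differentiable (at p)"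
    by simp
  obtain a c d l m :: real where field: "\<And>\<tau> z. Im \<tau> > 0 \<Longrightarrow> hamiltonian_field KB_form f (\<tau>, z) =
    (of_real a * \<tau>\<^sup>2 + 2 * of_real c * \<tau> + of_real d,
     (of_real a * \<tau> + of_real c) * z + of_real l * \<tau> + of_real m)"
    using kaehler_field_form[OF f] by blast
  \<comment> \<open>The matrix and the vector in \<open>L\<close> are read off from
    \<open>jacobi_field\<close>; the central coordinate stays free until the additive constant is
    known.\<close>
  define A :: "real ^ 2 ^ 2" where "A = vector [vector [c, d], vector [- a, - c]]"
  define L :: "real \<Rightarrow> jacobi_vec" where "L = (\<lambda>r. (A, vector [l, m], r))"
  have gJ: "L r \<in> gJ" for r
    by (simp add: L_def A_def gJ_def trace_def sum_2)
  have zero: "((\<lambda>p. f p - psi (L 0) p) has_derivative (\<lambda>h. 0)) (at p within SJ)" if p: "p \<in> SJ" for p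
  proof -
    have "hamiltonian_field KB_form f p = jacobi_field (L 0) p"
      using field[of "fst p" "snd p"] p by (simp add: SJ_iff jacobi_field_def split_beta L_def A_def)
    then have "frechet_derivative f (at p) = KB_form p (jacobi_field (L 0) p)"
      using KB_form_ham_vec[OF p linear_frechet_derivative[OF df[OF p]]] hamiltonian_field_KB[OF p df[OF p]]
      by (simp add: fun_eq_iff)
    then have "(f has_derivative KB_form p (jacobi_field (L 0) p)) (at p)"
      using df[OF p] unfolding frechet_derivative_works by simp
    from has_derivative_diff[OF this has_derivative_psi[OF p, of "L 0"]] show ?thesis
      by (simp add: has_derivative_at_withinI)
  qed
  have "convex SJ"
  proof -
    have "SJ = {\<tau>. Im \<tau> > 0} \<times> UNIV"
      by (auto simp: SJ_def)
    moreover have "convex ({\<tau>. Im \<tau> > 0} \<times> (UNIV :: complex set))"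
      by (intro convex_Times convex_halfspace_Im_gt convex_UNIV)
    ultimately show ?thesis
      by (rule ssubst)
  qed
  then obtain k where k: "\<And>p. p \<in> SJ \<Longrightarrow> f p - psi (L 0) p = k"
    using has_derivative_zero_constant[OF _ zero] by blast
  \<comment> \<open>\<open>psi gJ_R\<close> is the constant -1/4, so the constant \<open>k\<close>
    needs the central coordinate \<open>- 4 * k\<close>.\<close>
  have "f = psi (L (- 4 * k))"
  proof
    fix p
    show "f p = psi (L (- 4 * k)) p"
      using k[of p] by (cases "p \<in> SJ") (simp_all add: out psi_outside L_def psi_eq)
  qed
  then show "f \<in> psi ` gJ"
    using gJ by blast
qed (auto simp: psi_in_kaehler_functions)

section \<open>The two Lie algebra structures\<close>

lemma real_lie_algebra_gJ: "real_lie_algebra (*\<^sub>R) gJ gJ_bracket"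
proof unfold_locales
  have tr: "A $ 2 $ 2 = - A $ 1 $ 1" if "(A, \<xi>, r) \<in> gJ" for A :: "real ^ 2 ^ 2" and \<xi> r
    using that by (auto simp: gJ_def trace_def sum_2)
  note expand = gJ_bracket_def matrix_matrix_mult_def vector_matrix_mult_def sum_2 Omega_def
    vec_eq_iff forall_2 zero_prod_def
  show "module.subspace (*\<^sub>R) gJ"
    unfolding subspace_raw_def[symmetric]
    by (auto simp: subspace_def gJ_def trace_def sum_2 zero_prod_def algebra_simps simp flip: distrib_left)
  fix x y z :: jacobi_vec and c :: real
  assume "x \<in> gJ" "y \<in> gJ"
  then show "gJ_bracket x y \<in> gJ"
    by (auto simp: gJ_def expand trace_def)
  show "gJ_bracket (c *\<^sub>R x) y = c *\<^sub>R gJ_bracket x y"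
    "gJ_bracket x (c *\<^sub>R y) = c *\<^sub>R gJ_bracket x y"
    "gJ_bracket x x = 0"
    by (cases x; cases y; simp add: expand algebra_simps)+
  assume "z \<in> gJ"
  show "gJ_bracket (x + y) z = gJ_bracket x z + gJ_bracket y z"
    "gJ_bracket x (y + z) = gJ_bracket x y + gJ_bracket x z"
    by (cases x; cases y; cases z; simp add: expand algebra_simps)+
  obtain A \<xi> r where x: "x = (A, \<xi>, r)"
    by (cases x)
  obtain B \<eta> s where y: "y = (B, \<eta>, s)"
    by (cases y)
  obtain C \<zeta> t where z: "z = (C, \<zeta>, t)"
    by (cases z)
  \<comment> \<open>The central component of this identity expresses the invariance of
    \<open>Omega\<close> under sl(2), which is where trace zero enters.\<close>
  show "gJ_bracket x (gJ_bracket y z) + gJ_bracket y (gJ_bracket z x) + gJ_bracket z (gJ_bracket x y) = 0"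
    using tr[of A \<xi> r] tr[of B \<eta> s] tr[of C \<zeta> t] \<open>x \<in> gJ\<close> \<open>y \<in> gJ\<close> \<open>z \<in> gJ\<close>
    by (simp add: x y z expand algebra_simps)
qed

text \<open>Every element of the image is some \<open>h a\<close>, and all operations on such
  elements pull back to \<open>V\<close>, so each axiom on the image is \<open>h\<close> applied to
  the axiom on \<open>V\<close>. In this way the Jacobi identity of the Poisson bracket comes from
  \<open>gJ\<close>.\<close>

lemma real_lie_algebra_iso_transport:
  assumes "real_lie_algebra scale\<^sub>1 V bracket\<^sub>1" "vector_space scale\<^sub>2"
    and inj: "inj_on h V" and add: "\<And>x y. h (x + y) = h x + h y"
    and scale: "\<And>c x. h (scale\<^sub>1 c x) = scale\<^sub>2 c (h x)"
    and bracket: "\<And>x y. x \<in> V \<Longrightarrow> y \<in> V \<Longrightarrow> bracket\<^sub>2 (h x) (h y) = h (bracket\<^sub>1 x y)"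
  shows "real_lie_algebra_iso scale\<^sub>1 V bracket\<^sub>1 scale\<^sub>2 (h ` V) bracket\<^sub>2 h"
proof -
  interpret dom: real_lie_algebra scale\<^sub>1 V bracket\<^sub>1
    by fact
  interpret cod: vector_space scale\<^sub>2
    by fact
  note V = dom.subspace_add[OF dom.subspace_carrier] dom.subspace_scale[OF dom.subspace_carrier]
    dom.subspace_0[OF dom.subspace_carrier] dom.bracket_closed
  have h0: "h 0 = 0"
    using add[of 0 0] by simp
  note pull = add[symmetric] scale[symmetric] bracket V
  have "real_lie_algebra scale\<^sub>2 (h ` V) bracket\<^sub>2"
  proof unfold_locales
    show "cod.subspace (h ` V)"
    proof (rule cod.subspaceI)
      show "0 \<in> h ` V"
        using V(3) h0 by (metis image_eqI)
    qed (auto simp: pull)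
    fix x y z c
    assume "x \<in> h ` V" "y \<in> h ` V"
    then obtain a b where ab: "a \<in> V" "b \<in> V" "x = h a" "y = h b"
      by blast
    show "bracket\<^sub>2 x y \<in> h ` V"
      "bracket\<^sub>2 (scale\<^sub>2 c x) y = scale\<^sub>2 c (bracket\<^sub>2 x y)"
      "bracket\<^sub>2 x (scale\<^sub>2 c y) = scale\<^sub>2 c (bracket\<^sub>2 x y)"
      "bracket\<^sub>2 x x = 0"
      using ab by (simp_all add: pull dom.bracket_scale_left dom.bracket_scale_right dom.bracket_self h0)
    assume "z \<in> h ` V"
    then obtain e where e: "e \<in> V" "z = h e"
      by blast
    show "bracket\<^sub>2 (x + y) z = bracket\<^sub>2 x z + bracket\<^sub>2 y z"
      "bracket\<^sub>2 x (y + z) = bracket\<^sub>2 x y + bracket\<^sub>2 x z"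
      "bracket\<^sub>2 x (bracket\<^sub>2 y z) + bracket\<^sub>2 y (bracket\<^sub>2 z x) + bracket\<^sub>2 z (bracket\<^sub>2 x y) = 0"
      using ab e
      by (simp_all add: pull dom.bracket_add_left dom.bracket_add_right dom.jacobi_identity h0)
  qed
  then interpret cod': real_lie_algebra scale\<^sub>2 "h ` V" bracket\<^sub>2 .
  show ?thesis
    by unfold_locales (simp_all add: inj inj_on_imp_bij_betw add scale bracket)
qed

theorem proposition3p42:
  shows "real_lie_algebra_iso
           (*\<^sub>R) gJ gJ_bracket
           fun_scale (kaehler_functions SJ KB_metric SJ_J) (poisson_bracket SJ KB_form)
           psi"
proof -
  have "vector_space (fun_scale :: real \<Rightarrow> (complex \<times> complex \<Rightarrow> real) \<Rightarrow> _)"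
    by unfold_locales (auto simp: fun_scale_def fun_eq_iff algebra_simps)
  then show ?thesis
    unfolding psi_surj[symmetric]
    by (rule real_lie_algebra_iso_transport[OF real_lie_algebra_gJ])
      (simp_all add: inj_on_psi psi_add psi_scaleR poisson_bracket_psi)
qed

end
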